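(* Let $K$ be a Hilbertian field (for example, a number field) and let $L|K$ be a finite separable field extension. Let $f \colon L[X] \to L[X]$ be a $K$-linear bijection preserving the set of polynomials of $L[X]$ with a root in $L$. Then there are constants $a, c \in L^{\times}$, $b \in L$, and an automorphism $\sigma \in \mathrm{Aut}(L|K)$ such that $$\forall P \in L[X], \quad f(P) = c \cdot \sigma(P)(aX+b).$$ In other words, the set of $K$-linear bijections $L[X] \to L[X]$ preserving the set of polynomials with a root in $L$ is equal to $L^{\times} \rtimes \mathrm{Aut}_{K\text{-alg}}(L[X])$, i.e., to the set of maps of the form $P \mapsto c\,\varphi(P)$ with $c \in L^{\times}$ and $\varphi$ a $K$-algebra automorphism of $L[X]$.
   Context: A map $f$ preserves a set $S$ if $f(S) = S$. The zero polynomial has every element of $L$ as a root. $\mathrm{Aut}(L|K)$ is the group of field automorphisms of $L$ fixing $K$ pointwise; for $\sigma \in \mathrm{Aut}(L|K)$ and $P \in L[X]$, $\sigma(P)$ is the polynomial obtained by applying $\sigma$ to the coefficients of $P$, and $\sigma(P)(aX+b)$ is its composition with $aX+b$. A field $K$ is Hilbertian if it satisfies the conclusion of Hilbert's irreducibility theorem: for any finitely many irreducible polynomials $f_1,\dots,f_m \in K(T)[X]$, there are infinitely many $t \in K$ at which all coefficients of the $f_i$ are defined and such that each specialization $f_i(t,X)$ is irreducible in $K[X]$. Number fields are Hilbertian. *)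

theory Defs
  imports
    "HOL-Computational_Algebra.Polynomial"
    "HOL-Computational_Algebra.Fraction_Field"
    "HOL-Algebra.Bij"
    "HOL-Algebra.Coset"
    "Subresultants.Resultant_Prelim"
begin

section \<open>Hilbertian fields\<close>

text \<open>
  Elements of \<open>K(T)\<close> are fractions of polynomials in \<open>T\<close>. Such a fraction is defined at \<open>t\<close>
  if it has \<^emph>\<open>some\<close> representation (for instance the one in lowest terms) whose denominator
  does not vanish at \<open>t\<close>; the value does not depend on the chosen representation.
\<close>

definition defined_at :: "'k::field poly fract \<Rightarrow> 'k \<Rightarrow> bool" where
  "defined_at q t \<longleftrightarrow> (\<exists>n d. q = Fract n d \<and> poly d t \<noteq> 0)"

definition value_at :: "'k::field poly fract \<Rightarrow> 'k \<Rightarrow> 'k" where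
  "value_at q t = (THE v. \<exists>n d. q = Fract n d \<and> poly d t \<noteq> 0 \<and> v = poly n t / poly d t)"

lemma value_at_Fract:
  assumes "poly d t \<noteq> 0"
  shows "value_at (Fract n d) t = poly n t / poly d t"
  unfolding value_at_def
proof (rule the_equality)
  show "\<exists>n' d'. Fract n d = Fract n' d' \<and> poly d' t \<noteq> 0 \<and> poly n t / poly d t = poly n' t / poly d' t"
    using assms by blast
next
  fix v
  assume "\<exists>n' d'. Fract n d = Fract n' d' \<and> poly d' t \<noteq> 0 \<and> v = poly n' t / poly d' t"
  then obtain n' d' where *: "Fract n d = Fract n' d'" "poly d' t \<noteq> 0" "v = poly n' t / poly d' t"
    by blast
  from assms *(2) have "d \<noteq> 0" "d' \<noteq> 0" by auto
  with *(1) have "n * d' = n' * d" by (simp add: eq_fract)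
  then have "poly n t * poly d' t = poly n' t * poly d t" by (metis poly_mult)
  with assms *(2,3) show "v = poly n t / poly d t" by (simp add: frac_eq_eq)
qed

definition specialize :: "'k::field poly fract poly \<Rightarrow> 'k \<Rightarrow> 'k poly" where
  "specialize f t = map_poly (\<lambda>q. value_at q t) f"

lemma coeff_specialize: "coeff (specialize f t) i = value_at (coeff f i) t"
proof -
  have "value_at 0 t = 0"
    using value_at_Fract[of 1 t 0] by (simp add: fract_collapse)
  then show ?thesis by (simp add: specialize_def coeff_map_poly)
qed

definition hilbertian :: "'k::field itself \<Rightarrow> bool" where
  "hilbertian _ \<longleftrightarrow>
    (\<forall>F :: 'k poly fract poly set. finite F \<longrightarrow> (\<forall>f\<in>F. irreducible f) \<longrightarrow>
      infinite {t :: 'k. \<forall>f\<in>F. (\<forall>i. defined_at (coeff f i) t) \<and> irreducible (specialize f t)})"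

section \<open>Finite separable extensions\<close>

text \<open>
  A field extension \<open>L|K\<close> is given by a homomorphism \<open>\<iota>\<close> from \<open>K\<close> to \<open>L\<close> (automatically
  injective), which makes \<open>L\<close> and \<open>L[X]\<close> into vector spaces over \<open>K\<close>.
\<close>

definition finite_extension :: "('k::field \<Rightarrow> 'l::field) \<Rightarrow> bool" where
  "finite_extension \<iota> \<longleftrightarrow>
    comm_ring_hom \<iota> \<and> (\<exists>B. finite_dimensional_vector_space (\<lambda>k x. \<iota> k * x) B)"

text \<open>
  The irreducible polynomials over \<open>K\<close> with root \<open>x\<close> are the nonzero constant multiples of
  the minimal polynomial of \<open>x\<close>.
\<close>

definition separable_element :: "('k::field \<Rightarrow> 'l::field) \<Rightarrow> 'l \<Rightarrow> bool" where
  "separable_element \<iota> x \<longleftrightarrow>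
    (\<exists>p. irreducible p \<and> poly (map_poly \<iota> p) x = 0 \<and> coprime p (pderiv p))"

definition separable_extension :: "('k::field \<Rightarrow> 'l::field) \<Rightarrow> bool" where
  "separable_extension \<iota> \<longleftrightarrow> (\<forall>x. separable_element \<iota> x)"

section \<open>Automorphisms and linear bijections\<close>

definition field_Aut :: "('k::field \<Rightarrow> 'l::field) \<Rightarrow> ('l \<Rightarrow> 'l) set" where
  "field_Aut \<iota> = {\<sigma>. comm_ring_hom \<sigma> \<and> bij \<sigma> \<and> (\<forall>k. \<sigma> (\<iota> k) = \<iota> k)}"

definition poly_alg_Aut :: "('k::field \<Rightarrow> 'l::field) \<Rightarrow> ('l poly \<Rightarrow> 'l poly) set" where
  "poly_alg_Aut \<iota> = {\<phi>. comm_ring_hom \<phi> \<and> bij \<phi> \<and> (\<forall>k. \<phi> [:\<iota> k:] = [:\<iota> k:])}"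

definition polys_with_root :: "'l::field poly set" where
  "polys_with_root = {P. \<exists>x. poly P x = 0}"

definition root_preservers :: "('k::field \<Rightarrow> 'l::field) \<Rightarrow> ('l poly \<Rightarrow> 'l poly) set" where
  "root_preservers \<iota> =
    {f. Vector_Spaces.linear (\<lambda>k. smult (\<iota> k)) (\<lambda>k. smult (\<iota> k)) f \<and> bij f \<and>
        f ` polys_with_root = polys_with_root}"

definition root_preserver_group :: "('k::field \<Rightarrow> 'l::field) \<Rightarrow> ('l poly \<Rightarrow> 'l poly) monoid" where
  "root_preserver_group \<iota> = (BijGroup UNIV)\<lparr>carrier := root_preservers \<iota>\<rparr>"

text \<open>The group \<open>L\<^sup>\<times>\<close>, acting on \<open>L[X]\<close> by scalar multiplication.\<close>

definition scalings :: "('l::field poly \<Rightarrow> 'l poly) set" where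
  "scalings = {smult c | c. c \<noteq> 0}"

definition is_semidirect_product :: "('a, 'b) monoid_scheme \<Rightarrow> 'a set \<Rightarrow> 'a set \<Rightarrow> bool" where
  "is_semidirect_product G N H \<longleftrightarrow>
    normal N G \<and> subgroup H G \<and> N \<inter> H = {\<one>\<^bsub>G\<^esub>} \<and> N <#>\<^bsub>G\<^esub> H = carrier G"

end

theory Submission
  imports Defs "HOL-Computational_Algebra.Polynomial_Factorial"
begin

text \<open>
  Let \<open>f\<close> be a \<open>K\<close>-linear bijection of \<open>L[X]\<close> preserving the polynomials with a root in \<open>L\<close>. The
  polynomials vanishing at a point \<open>x\<close> form a \<open>K\<close>-subspace \<open>H\<^sub>x\<close> of finite codimension, and \<open>f(H\<^sub>x)\<close>
  is again a \<open>K\<close>-subspace of finite codimension all of whose elements have roots. The heart of the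
  proof is that such a space must have a \<^emph>\<open>common\<close> root
  (\<open>root_subspace_has_common_root\<close>), so that \<open>f(H\<^sub>x) \<subseteq> H\<^bsub>\<tau>(x)\<^esub>\<close> for some map \<open>\<tau>\<close> of \<open>L\<close>; the same
  statement for the inverse of \<open>f\<close> makes \<open>\<tau>\<close> injective.

  This is where Hilbert irreducibility enters. Let \<open>P \<noteq> 0\<close> and \<open>Q\<close> lie in such a space, with \<open>Q\<close>
  of much larger degree. Every \<open>Q + tP\<close> with \<open>t \<in> K\<close> has a root, and the claim
  \<open>common_root_if_pencil_has_roots\<close> is that \<open>P\<close> and \<open>Q\<close> then share a root. If they do not, a root
  \<open>x\<close> of \<open>Q + tP\<close> satisfies \<open>t = -Q(x)/P(x)\<close>. View \<open>L(X)\<close> as an extension of \<open>K(T)\<close> through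
  \<open>T \<mapsto> -Q/P\<close>. It is algebraic of degree greater than \<open>[L:K]\<close>, and because \<open>L|K\<close> is separable the
  argument of the primitive element theorem produces \<open>\<alpha> \<in> L\<close> such that \<open>X + \<alpha>\<close> generates it. The
  minimal polynomial of \<open>X + \<alpha>\<close> over \<open>K(T)\<close> thus has degree greater than \<open>[L:K]\<close>; a specialisation
  of it at a suitable \<open>t\<close> is irreducible over \<open>K\<close> of the same degree and has the root \<open>x + \<alpha> \<in> L\<close>,
  which is absurd. Fixing \<open>P\<close>, the whole space is now covered by finitely many subspaces,
  namely those of polynomials vanishing at a given root of \<open>P\<close> and that of polynomials of small
  degree. As \<open>K\<close> is infinite, one of them is everything, and it is not the last one.

  The rest is algebra. Put \<open>A\<^sub>u = f(u)\<close> for constants \<open>u\<close>. Then \<open>f(P)(\<tau>(x)) = A\<^bsub>P(x)\<^esub>(\<tau>(x))\<close>.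
  Letting \<open>x\<close> run through \<open>K\<close>, or through a coset \<open>x\<^sub>0 + K\<close>, turns this into polynomial identities,
  which give \<open>f(uX\<^sup>n) = h\<^sup>n A\<^sub>u\<close> for one polynomial \<open>h\<close>, and \<open>A\<^bsub>ux\<^esub> A\<^sub>1 = A\<^sub>x A\<^sub>u\<close>. All powers of
  \<open>A\<^sub>x/A\<^sub>1\<close> times \<open>A\<^sub>1\<close> are therefore polynomials of bounded degree, so \<open>A\<^sub>x = \<sigma>(x) A\<^sub>1\<close> with \<open>\<sigma>\<close> a field
  endomorphism, and \<open>f(P) = A\<^sub>1 \<sigma>(P)(h)\<close>. Surjectivity of \<open>f\<close> forces \<open>A\<^sub>1\<close> to be constant,
  \<open>deg h = 1\<close> and \<open>\<sigma>\<close> to be an automorphism (\<open>affine_form\<close>).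

  The same surjectivity argument shows that the \<open>K\<close>-algebra automorphisms of \<open>L[X]\<close> are precisely
  the maps \<open>P \<mapsto> \<sigma>(P)(aX + b)\<close> with \<open>a \<noteq> 0\<close>, which yields the description as a semidirect product.
\<close>

section \<open>Minimal polynomials and simple extensions\<close>

locale field_extension = field_hom hom for hom :: "'f::field \<Rightarrow> 'e::field"
begin

sublocale map_hom: map_poly_inj_idom_hom hom ..

sublocale vs: vector_space "\<lambda>a x. hom a * x"
  by unfold_locales (auto simp: algebra_simps hom_add hom_mult)

abbreviation eval_at :: "'f poly \<Rightarrow> 'e \<Rightarrow> 'e" where
  "eval_at p z \<equiv> poly (map_poly hom p) z"

definition adjoin :: "'e \<Rightarrow> 'e set" where
  "adjoin z = range (\<lambda>p. eval_at p z)"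

lemma eval_at_pCons: "eval_at (pCons a p) z = hom a + z * eval_at p z"
  by (simp add: map_poly_pCons_hom)

text \<open>
  The ideal of polynomials vanishing at \<open>z\<close> is generated by its nonzero element of least degree; that
  element is irreducible because one of the factors of any factorisation vanishes at \<open>z\<close> as well.
\<close>

lemma minimal_polynomial:
  assumes "q \<noteq> 0" "eval_at q z = 0"
  obtains m where "lead_coeff m = 1" "irreducible m" "eval_at m z = 0"
    "\<And>h. eval_at h z = 0 \<Longrightarrow> m dvd h"
proof -
  have ex: "\<exists>n p. p \<noteq> 0 \<and> eval_at p z = 0 \<and> degree p = n" using assms by blast
  define n where "n = (LEAST n. \<exists>p. p \<noteq> 0 \<and> eval_at p z = 0 \<and> degree p = n)"
  from LeastI_ex[OF ex] obtain p where p: "p \<noteq> 0" "eval_at p z = 0" "degree p = n"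
    unfolding n_def by blast
  have least: "n \<le> degree h" if "h \<noteq> 0" "eval_at h z = 0" for h
    unfolding n_def by (rule Least_le) (use that in blast)
  have dvd: "p dvd h" if h: "eval_at h z = 0" for h
  proof (rule ccontr)
    assume "\<not> p dvd h"
    then have ne: "h mod p \<noteq> 0" by (simp add: dvd_eq_mod_eq_0)
    have "h = p * (h div p) + h mod p" by simp
    then have "eval_at h z = eval_at p z * eval_at (h div p) z + eval_at (h mod p) z"
      by (metis map_hom.hom_add map_hom.hom_mult poly_add poly_mult)
    with h p have "eval_at (h mod p) z = 0" by simp
    with least[OF ne] degree_mod_less[of p h] p ne show False by auto
  qed
  have nu: "\<not> is_unit p"
  proof
    assume "is_unit p"
    then obtain c where "p = [:c:]" "c \<noteq> 0"
      by (metis is_unit_poly_iff not_is_unit_0 is_unit_field_poly degree_eq_zeroE p(1) pCons_0_0)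
    with p(2) show False by simp
  qed
  have irr: "irreducible p"
  proof (rule irreducibleI[OF p(1) nu])
    fix a b assume ab: "p = a * b"
    with p have nz: "a \<noteq> 0" "b \<noteq> 0" by auto
    have "eval_at a z * eval_at b z = 0" using p(2) unfolding ab by (simp add: map_hom.hom_mult)
    then consider "eval_at a z = 0" | "eval_at b z = 0" by auto
    then show "is_unit a \<or> is_unit b"
    proof cases
      case 1
      from least[OF nz(1) 1] p(3) have "degree b = 0"
        unfolding ab using nz by (simp add: degree_mult_eq)
      then show ?thesis using nz by simp
    next
      case 2
      from least[OF nz(2) 2] p(3) have "degree a = 0"
        unfolding ab using nz by (simp add: degree_mult_eq)
      then show ?thesis using nz by simp
    qed
  qed
  define m where "m = smult (inverse (lead_coeff p)) p"
  show ?thesis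
  proof
    show "lead_coeff m = 1" using p(1) by (simp add: m_def)
    show "irreducible m" using p(1) irr by (simp add: m_def)
    show "eval_at m z = 0" using p(2) by (simp add: m_def map_poly_hom_smult)
    show "m dvd h" if "eval_at h z = 0" for h
      using dvd[OF that] p(1) by (simp add: m_def smult_dvd_iff)
  qed
qed

text \<open>
  Finite-dimensionality enters in this form: \<open>card S + 1\<close> powers in a space spanned by \<open>card S\<close> vectors
  must be dependent. The degree bound is what later excludes irreducible polynomials of large degree.
\<close>

lemma algebraic_of_powers_in_span:
  assumes S: "finite S" and pow: "\<And>i. z ^ i \<in> vs.span S"
  obtains p where "p \<noteq> 0" "degree p \<le> card S" "eval_at p z = 0"
proof (cases "inj_on (\<lambda>i. z ^ i) {..card S}")
  case False
  then obtain i k where ik: "i < k" "k \<le> card S" "z ^ i = z ^ k"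
    unfolding inj_on_def by (metis atMost_iff linorder_neqE_nat)
  define p :: "'f poly" where "p = monom 1 k - monom 1 i"
  have "coeff p k = 1" using ik(1) by (simp add: p_def)
  then have "p \<noteq> 0" by auto
  moreover have "degree p \<le> card S"
    unfolding p_def using ik by (intro degree_diff_le) (auto intro: order_trans[OF degree_monom_le])
  moreover have "eval_at p z = 0"
    by (simp add: p_def map_hom.hom_minus poly_monom ik(3))
  ultimately show ?thesis using that by blast
next
  case inj: True
  let ?T = "(\<lambda>i. z ^ i) ` {..card S}"
  have "vs.dependent ?T"
  proof (rule ccontr)
    assume "\<not> vs.dependent ?T"
    from vs.independent_span_bound[OF S this] pow have "card ?T \<le> card S" by auto
    with card_image[OF inj] show False by simp
  qed
  then obtain u where u: "(\<Sum>v\<in>?T. hom (u v) * v) = 0" "\<exists>v\<in>?T. u v \<noteq> 0"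
    using vs.dependent_finite[of ?T] by auto
  define p where "p = (\<Sum>i\<le>card S. monom (u (z ^ i)) i)"
  have cf: "coeff p i = u (z ^ i)" if "i \<le> card S" for i
    using that by (simp add: p_def coeff_sum)
  from u(2) obtain i where "i \<le> card S" "u (z ^ i) \<noteq> 0" by auto
  with cf have "p \<noteq> 0" by force
  moreover have "degree p \<le> card S"
    unfolding p_def by (intro degree_sum_le) (auto intro: order_trans[OF degree_monom_le])
  moreover have "eval_at p z = (\<Sum>i\<le>card S. hom (u (z ^ i)) * z ^ i)"
    by (simp add: p_def map_hom.hom_sum poly_sum poly_monom)
  then have "eval_at p z = 0"
    using u(1) by (simp add: sum.reindex[OF inj])
  ultimately show ?thesis using that by blast
qed

lemma adjoin_hom: "hom a \<in> adjoin z"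
  unfolding adjoin_def by (rule range_eqI[of _ _ "[:a:]"]) (simp add: eval_at_pCons)

lemma adjoin_self: "z \<in> adjoin z"
  unfolding adjoin_def by (rule range_eqI[of _ _ "[:0, 1:]"]) (simp add: eval_at_pCons)

lemma adjoin_add: "x \<in> adjoin z \<Longrightarrow> y \<in> adjoin z \<Longrightarrow> x + y \<in> adjoin z"
  unfolding adjoin_def by (clarsimp simp flip: map_hom.hom_add poly_add)

lemma adjoin_mult: "x \<in> adjoin z \<Longrightarrow> y \<in> adjoin z \<Longrightarrow> x * y \<in> adjoin z"
  unfolding adjoin_def by (clarsimp simp flip: map_hom.hom_mult poly_mult)

lemma adjoin_uminus: "x \<in> adjoin z \<Longrightarrow> - x \<in> adjoin z"
  using adjoin_mult[OF adjoin_hom[of "- 1"], of x z] by (simp add: hom_uminus)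

lemma adjoin_diff: "x \<in> adjoin z \<Longrightarrow> y \<in> adjoin z \<Longrightarrow> x - y \<in> adjoin z"
  using adjoin_add[OF _ adjoin_uminus, of x z y] by simp

lemma adjoin_subset:
  assumes "x \<in> adjoin z"
  shows "adjoin x \<subseteq> adjoin z"
proof -
  have "eval_at p x \<in> adjoin z" for p
  proof (induction p)
    case 0
    then show ?case using adjoin_hom[of 0] by simp
  next
    case (pCons a p)
    then show ?case unfolding eval_at_pCons by (intro adjoin_add adjoin_mult adjoin_hom assms)
  qed
  then show ?thesis by (auto simp: adjoin_def[of x])
qed

text \<open>
  Dividing an annihilating polynomial by a power of the variable makes its constant term nonzero, and
  then the relation can be solved for \<open>1/x\<close>. Hence \<open>adjoin x\<close> is a field as soon as its elements
  are algebraic.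
\<close>

lemma inverse_in_adjoin:
  assumes "q \<noteq> 0" "eval_at q x = 0"
  shows "inverse x \<in> adjoin x"
proof (cases "x = 0")
  case False
  have "\<exists>r. coeff r 0 \<noteq> 0 \<and> eval_at r x = 0"
    using assms
  proof (induction q)
    case (pCons a q)
    show ?case
    proof (cases "a = 0")
      case True
      with pCons False show ?thesis by (auto simp: eval_at_pCons)
    next
      case nz: False
      with pCons show ?thesis by (intro exI[of _ "pCons a q"]) auto
    qed
  qed simp
  then obtain r where r: "coeff r 0 \<noteq> 0" "eval_at r x = 0" by blast
  obtain c s where rs: "r = pCons c s" by (cases r)
  with r have c: "c \<noteq> 0" "hom c + x * eval_at s x = 0" by (auto simp: eval_at_pCons)
  then have e: "x * eval_at s x = - hom c" by (simp only: eq_neg_iff_add_eq_0 add.commute)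
  have "hom (- inverse c) * (x * eval_at s x) = 1"
    unfolding e using c(1) by (simp add: hom_uminus hom_inverse)
  then have "x * (hom (- inverse c) * eval_at s x) = 1" by (simp only: ac_simps)
  then have "inverse x = hom (- inverse c) * eval_at s x" by (rule inverse_unique)
  also have "\<dots> \<in> adjoin x" by (intro adjoin_mult adjoin_hom) (auto simp: adjoin_def)
  finally show ?thesis .
qed (use adjoin_hom[of 0] in auto)

lemma adjoin_subset_span_powers:
  assumes m: "m \<noteq> 0" "eval_at m z = 0"
  shows "adjoin z \<subseteq> vs.span ((\<lambda>i. z ^ i) ` {..<degree m})"
proof
  fix y assume "y \<in> adjoin z"
  then obtain p where y: "y = eval_at p z" by (auto simp: adjoin_def)
  have "p = m * (p div m) + p mod m" by simp
  then have "eval_at p z = eval_at m z * eval_at (p div m) z + eval_at (p mod m) z"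
    by (metis map_hom.hom_add map_hom.hom_mult poly_add poly_mult)
  with m y have y: "y = eval_at (p mod m) z" by simp
  have lt: "i < degree m" if "i \<le> degree (p mod m)" "p mod m \<noteq> 0" for i
    using degree_mod_less[of m p] m that by auto
  show "y \<in> vs.span ((\<lambda>i. z ^ i) ` {..<degree m})"
  proof (cases "p mod m = 0")
    case True
    then show ?thesis using y by (simp add: vs.span_zero)
  next
    case False
    then show ?thesis
      unfolding y poly_altdef
      by (intro vs.span_sum) (auto intro!: vs.span_scale[OF vs.span_base] lt simp: degree_map_poly_hom)
  qed
qed

end

text \<open>
  A common root of \<open>p\<close> and its derivative would make the minimal polynomial a common divisor. So an
  element is separable exactly in the sense needed below: it is a simple root of a polynomial over the
  base field.
\<close>

lemma (in field_extension) separable_simple_root: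
  assumes "irreducible p" "eval_at p \<beta> = 0" "coprime p (pderiv p)"
  shows "eval_at (pderiv p) \<beta> \<noteq> 0"
proof
  assume d: "eval_at (pderiv p) \<beta> = 0"
  from assms(1) have "p \<noteq> 0" by auto
  then obtain m where m: "irreducible m" "\<And>h. eval_at h \<beta> = 0 \<Longrightarrow> m dvd h"
    using minimal_polynomial[OF _ assms(2)] by metis
  have "is_unit m" by (rule coprime_common_divisor[OF assms(3) m(2)[OF assms(2)] m(2)[OF d]])
  with m(1) show False using irreducible_not_unit by blast
qed

section \<open>Primitive elements\<close>

definition poly_over :: "'a::comm_ring_1 set \<Rightarrow> 'a poly set" where
  "poly_over M = {p. \<forall>i. coeff p i \<in> M}"

text \<open>
  The minimal polynomial over an intermediate field that is given only as a subset \<open>M\<close> of the large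
  field. Divisibility is asserted in the polynomial ring of the large field, where several such
  polynomials, for different \<open>M\<close>, can be compared. The division by \<open>g\<close> is done by hand, one leading
  term at a time, so that coefficients visibly stay in \<open>M\<close>.
\<close>

lemma subfield_minimal_polynomial:
  fixes M :: "'a::field set"
  assumes diff: "\<And>x y. x \<in> M \<Longrightarrow> y \<in> M \<Longrightarrow> x - y \<in> M"
    and mult: "\<And>x y. x \<in> M \<Longrightarrow> y \<in> M \<Longrightarrow> x * y \<in> M"
    and inv: "\<And>x. x \<in> M \<Longrightarrow> inverse x \<in> M"
    and r: "r \<in> poly_over M" "r \<noteq> 0" "poly r \<beta> = 0"
  obtains g where "g \<in> poly_over M" "lead_coeff g = 1" "poly g \<beta> = 0"
    "\<And>h. h \<in> poly_over M \<Longrightarrow> poly h \<beta> = 0 \<Longrightarrow> g dvd h"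
proof -
  have zero: "0 \<in> M" using diff[of "coeff r 0" "coeff r 0"] r(1) by (simp add: poly_over_def)
  let ?A = "\<lambda>p. p \<noteq> 0 \<and> p \<in> poly_over M \<and> poly p \<beta> = 0"
  obtain p where p: "?A p" and least: "\<And>h. ?A h \<Longrightarrow> degree p \<le> degree h"
    using ex_has_least_nat[of ?A r degree] r by blast
  define g where "g = smult (inverse (lead_coeff p)) p"
  have g: "g \<in> poly_over M" "lead_coeff g = 1" "poly g \<beta> = 0" "degree g = degree p"
    using p by (auto simp: g_def poly_over_def intro!: mult inv)
  have "g dvd h" if "h \<in> poly_over M" "poly h \<beta> = 0" for h
    using that
  proof (induction "degree h" arbitrary: h rule: less_induct)
    case less
    show ?case
    proof (cases "h = 0 \<or> degree h = 0")
      case True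
      show ?thesis
      proof (cases "h = 0")
        case False
        with True have "degree h = 0" by simp
        then obtain c where "h = [:c:]" by (metis degree_eq_zeroE)
        with less.prems False show ?thesis by simp
      qed simp
    next
      case False
      define h' where "h' = h - monom (lead_coeff h) (degree h - degree g) * g"
      have le: "degree g \<le> degree h" using least[of h] less.prems False g by auto
      have h'M: "h' \<in> poly_over M"
        using less.prems(1) g(1) zero
        by (auto simp: h'_def poly_over_def coeff_monom_mult intro!: diff mult)
      have h'0: "poly h' \<beta> = 0" using less.prems g by (simp add: h'_def)
      have "degree (monom (lead_coeff h) (degree h - degree g) * g) \<le> degree h"
        using degree_mult_le[of "monom (lead_coeff h) (degree h - degree g)" g]
          degree_monom_le[of "lead_coeff h" "degree h - degree g"] le by linarith
      then have d1: "degree h' \<le> degree h" unfolding h'_def by (intro degree_diff_le) auto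
      have "coeff h' (degree h) = 0"
        using le g(2) by (simp add: h'_def coeff_monom_mult)
      then have "degree h' < degree h"
        using d1 False by (metis le_neq_implies_less leading_coeff_0_iff degree_0 neq0_conv)
      from less.hyps[OF this h'M h'0] have "g dvd h'" .
      then have "g dvd h' + monom (lead_coeff h) (degree h - degree g) * g" by simp
      then show ?thesis by (simp add: h'_def)
    qed
  qed
  with g that show ?thesis by blast
qed

text \<open>
  A pigeonhole principle: \<open>r\<close> has, up to units, only finitely many irreducible divisors, so if each of
  infinitely many polynomials shares one with \<open>r\<close>, a single one occurs infinitely often. The induction
  strips off one irreducible divisor at a time.
\<close>

lemma common_irreducible_factor:
  fixes r :: "'a::field poly" and q :: "'b \<Rightarrow> 'a poly"
  assumes "infinite S" "r \<noteq> 0"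
    and "\<And>s. s \<in> S \<Longrightarrow> \<exists>h. irreducible h \<and> h dvd r \<and> h dvd q s"
  obtains \<pi> where "irreducible \<pi>" "\<pi> dvd r" "infinite {s \<in> S. \<pi> dvd q s}"
proof -
  have "\<exists>\<pi>. irreducible \<pi> \<and> \<pi> dvd r \<and> infinite {s \<in> S. \<pi> dvd q s}"
    using assms
  proof (induction "degree r" arbitrary: r S rule: less_induct)
    case less
    from less.prems(1) obtain s0 where "s0 \<in> S" by (metis finite.emptyI ex_in_conv)
    from less.prems(3)[OF this] obtain h0 where h0: "irreducible h0" "h0 dvd r" by blast
    from h0(2) obtain w where w: "r = h0 * w" by (elim dvdE)
    with less.prems(2) have nz: "h0 \<noteq> 0" "w \<noteq> 0" by auto
    have dh0: "degree h0 > 0" using h0(1) by (auto simp: irreducible_def)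
    have split: "h dvd h0 \<or> h dvd w" if "irreducible h" "h dvd r" for h
      using field_poly_irreducible_imp_prime[OF that(1)] that(2) unfolding w
      by (simp add: prime_elem_dvd_mult_iff)
    \<comment> \<open>Either \<open>h0\<close> serves infinitely many \<open>s\<close>, or it may be discarded together with finitely many \<open>s\<close>.\<close>
    let ?S0 = "{s \<in> S. h0 dvd q s}"
    show ?case
    proof (cases "infinite ?S0")
      case True
      with h0 show ?thesis by blast
    next
      case False
      then have inf: "infinite (S - ?S0)" using less.prems(1) by (metis Diff_infinite_finite)
      have "\<exists>\<pi>. irreducible \<pi> \<and> \<pi> dvd w \<and> infinite {s \<in> S - ?S0. \<pi> dvd q s}"
      proof (rule less.hyps[OF _ inf nz(2)])
        show "degree w < degree r" unfolding w using nz dh0 by (simp add: degree_mult_eq)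
        fix s assume s: "s \<in> S - ?S0"
        with less.prems(3) obtain h where h: "irreducible h" "h dvd r" "h dvd q s" by blast
        have "\<not> h dvd h0"
        proof
          assume "h dvd h0"
          then have "h0 dvd h"
            using h0(1) h(1) by (meson irreducibleD' irreducible_not_unit)
          with h(3) s show False by (auto intro: dvd_trans)
        qed
        with split[OF h(1,2)] h show "\<exists>h. irreducible h \<and> h dvd w \<and> h dvd q s" by blast
      qed
      then obtain \<pi> where \<pi>: "irreducible \<pi>" "\<pi> dvd w" "infinite {s \<in> S - ?S0. \<pi> dvd q s}" by blast
      from \<pi>(3) have "infinite {s \<in> S. \<pi> dvd q s}"
        by (rule contrapos_nn) (auto elim: finite_subset[rotated])
      with \<pi> show ?thesis unfolding w by (meson dvd_mult)
    qed
  qed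
  with that show ?thesis by blast
qed

text \<open>
  Modulo \<open>\<pi>\<close> the polynomial \<open>\<Sum> c\<^sub>i S\<^sup>i\<close> in a new variable \<open>S\<close> vanishes at infinitely many scalars, hence
  identically. This is applied coefficient by coefficient to the remainders modulo \<open>\<pi>\<close>.
\<close>

lemma dvd_coefficients_if_dvd_infinitely_many_values:
  fixes c :: "nat \<Rightarrow> 'a::field poly"
  assumes inf: "infinite S" and dvd: "\<And>s. s \<in> S \<Longrightarrow> \<pi> dvd (\<Sum>i\<le>k. smult (s ^ i) (c i))"
    and "i \<le> k"
  shows "\<pi> dvd c i"
proof -
  have "coeff (c i mod \<pi>) l = 0" for l
  proof -
    define u where "u = (\<Sum>i\<le>k. monom (coeff (c i mod \<pi>) l) i)"
    have "poly u s = 0" if "s \<in> S" for s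
    proof -
      have sum_mod: "(\<Sum>i\<in>A. smult (s ^ i) (c i)) mod \<pi> = (\<Sum>i\<in>A. smult (s ^ i) (c i mod \<pi>))"
        if "finite A" for A
        using that by induction (auto simp: poly_mod_add_left mod_smult_left)
      have "poly u s = coeff ((\<Sum>i\<le>k. smult (s ^ i) (c i)) mod \<pi>) l"
        unfolding sum_mod[OF finite_atMost] by (simp add: u_def poly_sum poly_monom coeff_sum mult.commute)
      with dvd[OF that] show ?thesis by (simp add: dvd_eq_mod_eq_0)
    qed
    then have "S \<subseteq> {s. poly u s = 0}" by blast
    then have "u = 0" using inf poly_roots_finite[of u] finite_subset by blast
    then have "coeff u i = 0" by simp
    then show ?thesis using \<open>i \<le> k\<close> by (simp add: u_def coeff_sum)
  qed
  then show ?thesis by (simp add: poly_eq_iff dvd_eq_mod_eq_0)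
qed

lemma poly_over_pcompose:
  assumes zero: "0 \<in> M" and add: "\<And>x y. x \<in> M \<Longrightarrow> y \<in> M \<Longrightarrow> x + y \<in> M"
    and mult: "\<And>x y. x \<in> M \<Longrightarrow> y \<in> M \<Longrightarrow> x * y \<in> M"
    and "p \<in> poly_over M" "q \<in> poly_over M"
  shows "pcompose p q \<in> poly_over M"
  using assms(4)
proof (induction p)
  case 0
  then show ?case by simp
next
  case (pCons a p)
  have a: "a \<in> M" and p: "p \<in> poly_over M"
    using pCons.prems by (auto simp: poly_over_def coeff_pCons split: nat.splits)
  have sum: "(\<Sum>i\<in>A. f i) \<in> M" if "\<And>i. i \<in> A \<Longrightarrow> f i \<in> M" for A :: "nat set" and f
    using that by (induction A rule: infinite_finite_induct) (auto intro: zero add)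
  have "coeff (q * pcompose p q) i \<in> M" for i
    unfolding coeff_mult using assms(5) pCons.IH[OF p]
    by (auto simp: poly_over_def intro!: sum mult)
  then show ?case
    using a zero by (auto simp: pcompose_pCons poly_over_def coeff_pCons intro!: add split: nat.splits)
qed

context field_extension
begin

text \<open>
  The primitive element theorem in a form that requires separability of \<open>\<beta>\<close> only and allows \<open>s\<close> to be
  chosen from any prescribed infinite set.

  Suppose \<open>\<beta>\<close> is not in \<open>F(\<gamma> + s\<beta>)\<close> for any \<open>s\<close> in \<open>S\<close>. Its minimal polynomial over that field is then
  not linear, and it divides both \<open>p(Y)\<close> and \<open>q(\<gamma> + s(\<beta> - Y))\<close>, where \<open>q\<close> annihilates \<open>\<gamma>\<close>. Removing the
  factor \<open>Y - \<beta>\<close>, there remains a common irreducible factor of \<open>p(Y)/(Y - \<beta>)\<close> and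
  \<open>q(\<gamma> + s(\<beta> - Y))\<close>. By the pigeonhole principle one \<open>\<pi>\<close> serves infinitely many \<open>s\<close>, so \<open>\<pi>\<close> divides
  every coefficient in \<open>s\<close>; the leading one is a multiple of a power of \<open>\<beta> - Y\<close>. Thus \<open>\<pi>\<close> vanishes at
  \<open>\<beta>\<close>, contradicting that \<open>\<beta>\<close> is a simple root of \<open>p\<close>.
\<close>

lemma primitive_element:
  assumes alg: "\<And>z. \<exists>q. q \<noteq> 0 \<and> eval_at q z = 0"
    and S: "infinite S"
    and p: "eval_at p \<beta> = 0" "eval_at (pderiv p) \<beta> \<noteq> 0"
  obtains s where "s \<in> S" "\<beta> \<in> adjoin (\<gamma> + hom s * \<beta>)"
proof (rule ccontr)
  assume "\<not> thesis"
  with that have bad: "\<beta> \<notin> adjoin (\<gamma> + hom s * \<beta>)" if "s \<in> S" for s using that by blast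
  obtain q where q: "q \<noteq> 0" "eval_at q \<gamma> = 0" using alg by blast
  define P where "P = map_poly hom p"
  have P: "poly P \<beta> = 0" "poly (pderiv P) \<beta> \<noteq> 0"
    using p by (auto simp: P_def map_poly_pderiv)
  from P(1) obtain P1 where P1: "P = [:- \<beta>, 1:] * P1" by (auto simp: poly_eq_0_iff_dvd)
  have P1\<beta>: "poly P1 \<beta> \<noteq> 0"
    using P(2) unfolding P1 pderiv_mult by (simp add: pderiv_pCons)
  \<comment> \<open>Expanding \<open>q\<close> around \<open>\<gamma>\<close> turns \<open>q(\<gamma> + s(\<beta> - Y))\<close> into \<open>\<Sum> c\<^sub>i s\<^sup>i (\<beta> - Y)\<^sup>i\<close>, a polynomial in \<open>s\<close>.\<close>
  define c where "c = pcompose (map_poly hom q) [:\<gamma>, 1:]"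
  define k where "k = degree c"
  have c0: "c \<noteq> 0"
    using q(1) pcompose_eq_0[of "map_poly hom q" "[:\<gamma>, 1:]"] by (auto simp: c_def)
  define w where "w = [:\<beta>, - 1:]"
  define Q where "Q s = (\<Sum>i\<le>k. smult (s ^ i) (smult (coeff c i) (w ^ i)))" for s
  have Q: "Q s = pcompose (map_poly hom q) [:\<gamma> + s * \<beta>, - s:]" for s
  proof -
    have "[:\<gamma> + s * \<beta>, - s:] = pcompose [:\<gamma>, 1:] (smult s w)" by (simp add: w_def pcompose_pCons)
    then have "pcompose (map_poly hom q) [:\<gamma> + s * \<beta>, - s:] = pcompose c (smult s w)"
      by (simp only: c_def pcompose_assoc)
    also have "\<dots> = Q s"
      unfolding Q_def pcompose_altdef poly_altdef k_def
      by (simp add: degree_map_poly coeff_map_poly smult_power ac_simps)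
    finally show ?thesis ..
  qed
  have common: "\<exists>h. irreducible h \<and> h dvd P1 \<and> h dvd Q (hom s)" if s: "s \<in> S" for s
  proof -
    define \<delta> where "\<delta> = \<gamma> + hom s * \<beta>"
    have over: "map_poly hom u \<in> poly_over (adjoin \<delta>)" for u
      by (simp add: poly_over_def adjoin_hom)
    have inv: "inverse x \<in> adjoin \<delta>" if "x \<in> adjoin \<delta>" for x
      using alg[of x] inverse_in_adjoin[of _ x] adjoin_subset[OF that] by blast
    obtain r where r: "r \<noteq> 0" "eval_at r \<beta> = 0" using alg by blast
    obtain g where g: "g \<in> poly_over (adjoin \<delta>)" "lead_coeff g = 1" "poly g \<beta> = 0"
      and gdvd: "\<And>h. h \<in> poly_over (adjoin \<delta>) \<Longrightarrow> poly h \<beta> = 0 \<Longrightarrow> g dvd h"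
      using subfield_minimal_polynomial[of "adjoin \<delta>" "map_poly hom r" \<beta>, OF adjoin_diff adjoin_mult inv over] r by auto
    from g(3) obtain h where h: "g = [:- \<beta>, 1:] * h" by (auto simp: poly_eq_0_iff_dvd)
    have h0: "h \<noteq> 0" using g(2) h by auto
    have "degree h \<noteq> 0"
    proof
      assume "degree h = 0"
      then obtain a where a: "h = [:a:]" by (metis degree_eq_zeroE)
      with g(2) h h0 have "a = 1" by (simp split: if_splits)
      then have "coeff g 0 = - \<beta>" unfolding h a by simp
      with g(1) have "- \<beta> \<in> adjoin \<delta>" by (metis (no_types, lifting) mem_Collect_eq poly_over_def)
      from adjoin_uminus[OF this] bad[OF s] show False by (simp add: \<delta>_def)
    qed
    then obtain h1 h2 where h12: "irreducible h1" "h = h1 * h2"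
      using irreducible_monic_factor[of h] by auto
    have "g dvd P" unfolding P_def by (rule gdvd[OF over p(1)])
    then have "h dvd P1" unfolding h P1 by (simp only: dvd_mult_cancel_left) simp
    moreover have "g dvd Q (hom s)"
    proof (rule gdvd)
      have "[:\<delta>, - hom s:] \<in> poly_over (adjoin \<delta>)"
        by (auto simp: poly_over_def coeff_pCons split: nat.splits
            intro: adjoin_self adjoin_uminus adjoin_hom adjoin_hom[of 0, simplified])
      then show "Q (hom s) \<in> poly_over (adjoin \<delta>)"
        unfolding Q \<delta>_def[symmetric]
        by (intro poly_over_pcompose[OF _ adjoin_add adjoin_mult over])
          (auto intro: adjoin_hom[of 0, simplified])
      show "poly (Q (hom s)) \<beta> = 0" using q(2) by (simp add: Q poly_pcompose)
    qed
    ultimately show ?thesis using h12 unfolding h by (meson dvd_mult_left dvd_mult_right dvd_trans dvd_triv_left)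
  qed
  have P10: "P1 \<noteq> 0" using P1\<beta> by auto
  have "inj_on hom S" by (simp add: inj_on_def)
  with S have inf: "infinite (hom ` S)" by (simp add: finite_image_iff)
  obtain \<pi> where \<pi>: "irreducible \<pi>" "\<pi> dvd P1" "infinite {s \<in> hom ` S. \<pi> dvd Q s}"
  proof (rule common_irreducible_factor[OF inf P10])
    show "\<exists>h. irreducible h \<and> h dvd P1 \<and> h dvd Q s" if "s \<in> hom ` S" for s
      using that common by blast
  qed
  from dvd_coefficients_if_dvd_infinitely_many_values[OF \<pi>(3), where c = "\<lambda>i. smult (coeff c i) (w ^ i)" and k = k and i = k]
  have "\<pi> dvd smult (coeff c k) (w ^ k)" by (simp add: Q_def)
  then have "\<pi> dvd w ^ k" using c0 by (simp add: k_def dvd_smult_iff)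
  then have "\<pi> dvd w" using field_poly_irreducible_imp_prime[OF \<pi>(1)] prime_elem_dvd_power by blast
  then obtain v where v: "w = \<pi> * v" by (elim dvdE)
  have "w \<noteq> 0" "degree w = 1" by (simp_all add: w_def)
  with v have "degree \<pi> + degree v = 1" by (metis degree_mult_eq mult_eq_0_iff)
  moreover have "degree \<pi> > 0" using \<pi>(1) by (auto simp: irreducible_def)
  ultimately have "degree v = 0" by simp
  then obtain a where "v = [:a:]" by (metis degree_eq_zeroE)
  with v have "smult a \<pi> = w" by simp
  moreover have "poly w \<beta> = 0" by (simp add: w_def)
  moreover have "w \<noteq> 0" by (simp add: w_def)
  ultimately have "poly \<pi> \<beta> = 0" by auto
  with \<pi>(2) P1\<beta> show False by (metis dvdE mult_zero_left poly_mult)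
qed

end

section \<open>Rational functions and their values\<close>

lemma to_fract_power: "to_fract (p ^ n) = to_fract p ^ n"
  by (induction n) simp_all

lemma defined_at_Fract: "poly d t \<noteq> 0 \<Longrightarrow> defined_at (Fract n d) t"
  unfolding defined_at_def by blast

lemma defined_at_cases:
  assumes "defined_at q t"
  obtains n d where "q = Fract n d" "poly d t \<noteq> 0" "d \<noteq> 0" "value_at q t = poly n t / poly d t"
proof -
  from assms obtain n d where nd: "q = Fract n d" "poly d t \<noteq> 0" by (auto simp: defined_at_def)
  then have "d \<noteq> 0" by auto
  with nd that show ?thesis by (metis value_at_Fract)
qed

lemma defined_at_to_fract: "defined_at (to_fract p) t"
  unfolding to_fract_def by (rule defined_at_Fract) simp

lemma value_at_to_fract: "value_at (to_fract p) t = poly p t"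
  unfolding to_fract_def by (subst value_at_Fract) auto

lemma value_at_add:
  assumes "defined_at q t" "defined_at r t"
  shows "defined_at (q + r) t \<and> value_at (q + r) t = value_at q t + value_at r t"
proof -
  obtain a b where ab: "q = Fract a b" "poly b t \<noteq> 0" "b \<noteq> 0" "value_at q t = poly a t / poly b t"
    using assms(1) by (rule defined_at_cases)
  obtain c d where cd: "r = Fract c d" "poly d t \<noteq> 0" "d \<noteq> 0" "value_at r t = poly c t / poly d t"
    using assms(2) by (rule defined_at_cases)
  have nz: "poly (b * d) t \<noteq> 0" using ab cd by simp
  have "q + r = Fract (a * d + c * b) (b * d)" using ab cd by simp
  with defined_at_Fract[OF nz] value_at_Fract[OF nz] ab cd show ?thesis
    by (simp add: add_frac_eq)
qed

lemma value_at_mult: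
  assumes "defined_at q t" "defined_at r t"
  shows "defined_at (q * r) t \<and> value_at (q * r) t = value_at q t * value_at r t"
proof -
  obtain a b where ab: "q = Fract a b" "poly b t \<noteq> 0" "b \<noteq> 0" "value_at q t = poly a t / poly b t"
    using assms(1) by (rule defined_at_cases)
  obtain c d where cd: "r = Fract c d" "poly d t \<noteq> 0" "d \<noteq> 0" "value_at r t = poly c t / poly d t"
    using assms(2) by (rule defined_at_cases)
  have nz: "poly (b * d) t \<noteq> 0" using ab cd by simp
  have "q * r = Fract (a * c) (b * d)" using ab cd by simp
  with defined_at_Fract[OF nz] value_at_Fract[OF nz] ab cd show ?thesis by simp
qed

lemma value_at_inverse:
  assumes "defined_at q t" "value_at q t \<noteq> 0"
  shows "defined_at (inverse q) t \<and> value_at (inverse q) t = inverse (value_at q t)"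
proof -
  obtain a b where ab: "q = Fract a b" "poly b t \<noteq> 0" "b \<noteq> 0" "value_at q t = poly a t / poly b t"
    using assms(1) by (rule defined_at_cases)
  then have nz: "poly a t \<noteq> 0" using assms(2) by simp
  have "inverse q = Fract b a" using ab by simp
  with defined_at_Fract[OF nz] value_at_Fract[OF nz] ab show ?thesis by simp
qed

text \<open>
  Evaluation at \<open>t\<close> is a ring homomorphism on the rational functions defined at \<open>t\<close>; consequently a
  polynomial relation between such functions specialises to one between their values.
\<close>

lemma value_at_poly:
  assumes "\<And>i. defined_at (coeff p i) t" "defined_at y t"
  shows "defined_at (poly p y) t \<and> value_at (poly p y) t = poly (specialize p t) (value_at y t)"
  using assms(1)
proof (induction p)
  case 0
  have "specialize 0 t = 0" by (simp add: specialize_def)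
  then show ?case using defined_at_to_fract[of 0 t] value_at_to_fract[of 0 t] by simp
next
  case (pCons a p)
  have a: "defined_at a t" using pCons.prems[of 0] by simp
  have p: "defined_at (coeff p i) t" for i using pCons.prems[of "Suc i"] by simp
  have "specialize (pCons a p) t = pCons (value_at a t) (specialize p t)"
    by (simp add: poly_eq_iff coeff_specialize coeff_pCons split: nat.splits)
  with pCons.IH[OF p] a assms(2) show ?case
    using value_at_mult[of y t "poly p y"] value_at_add[of a t "y * poly p y"] by simp
qed

lemma fract_common_denominator:
  assumes "finite A"
  obtains D m where "D \<noteq> 0" "\<And>a. a \<in> A \<Longrightarrow> to_fract D * u a = to_fract (m a)"
proof -
  have "\<exists>D m. D \<noteq> 0 \<and> (\<forall>a\<in>A. to_fract D * u a = to_fract (m a))"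
    using assms
  proof induction
    case empty
    show ?case by (intro exI[of _ 1]) simp
  next
    case (insert x A)
    then obtain D m where D: "D \<noteq> 0" "\<forall>a\<in>A. to_fract D * u a = to_fract (m a)" by blast
    obtain n d where nd: "u x = Fract n d" "d \<noteq> 0" by (cases "u x")
    have "to_fract (d * D) * u a = to_fract (if a = x then D * n else d * m a)" if "a \<in> insert x A" for a
    proof (cases "a = x")
      case True
      then show ?thesis using nd by (simp add: Fract_conv_to_fract)
    next
      case False
      with that D(2) show ?thesis by (simp add: mult.assoc)
    qed
    moreover have "d * D \<noteq> 0" using D nd by simp
    ultimately show ?case by (intro exI[of _ "d * D"]
          exI[of _ "\<lambda>a. if a = x then D * n else d * m a"]) blast
  qed
  with that show ?thesis by blast
qed

text \<open>
  The universal property of the fraction field.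
\<close>

lemma fraction_field_hom_exists:
  assumes "inj_idom_hom (h :: 'a::idom \<Rightarrow> 'e::field)"
  obtains j where "field_hom j" "\<And>a b. b \<noteq> 0 \<Longrightarrow> j (Fract a b) = h a / h b"
proof -
  interpret h: inj_idom_hom h by fact
  define j where "j q = (THE v. \<exists>a b. q = Fract a b \<and> b \<noteq> 0 \<and> v = h a / h b)" for q
  have j: "j (Fract a b) = h a / h b" if b: "b \<noteq> 0" for a b
    unfolding j_def
  proof (rule the_equality)
    show "\<exists>a' b'. Fract a b = Fract a' b' \<and> b' \<noteq> 0 \<and> h a / h b = h a' / h b'" using b by blast
    fix v assume "\<exists>a' b'. Fract a b = Fract a' b' \<and> b' \<noteq> 0 \<and> v = h a' / h b'"
    then obtain a' b' where *: "Fract a b = Fract a' b'" "b' \<noteq> 0" "v = h a' / h b'" by blast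
    then have "a * b' = a' * b" using b by (simp add: eq_fract)
    then have "h a * h b' = h a' * h b" by (metis h.hom_mult)
    with * b show "v = h a / h b" by (simp add: frac_eq_eq)
  qed
  have "field_hom j"
  proof
    show "j 0 = 0" using j[of 1 0] by (simp add: fract_collapse)
    show "j 1 = 1" using j[of 1 1] by (simp add: fract_collapse)
    show "j (x + y) = j x + j y" for x y
      by (cases x; cases y) (simp add: j h.hom_add h.hom_mult add_frac_eq)
    show "j (x * y) = j x * j y" for x y
      by (cases x; cases y) (simp add: j h.hom_mult)
  qed
  with j that show ?thesis by blast
qed

lemma field_hom_constants: "field_hom (\<lambda>x::'a::field. to_fract [:x:])"
proof
  show "to_fract [:0::'a:] = 0" by simp
  show "to_fract [:1::'a:] = 1" by (simp flip: one_pCons)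
  show "to_fract [:x + y:] = to_fract [:x:] + to_fract [:y:]" for x y :: 'a
    by (simp flip: to_fract_add)
  show "to_fract [:x * y:] = to_fract [:x:] * to_fract [:y:]" for x y :: 'a
    by (simp flip: to_fract_mult)
qed

text \<open>
  With \<open>\<phi> = -Q/P\<close>, the highest power of \<open>Q\<close> dominates in \<open>P\<^sup>n A(\<phi>)\<close>, where \<open>n = deg A\<close>, because
  \<open>deg P < deg Q\<close>. The lemma shows that \<open>\<phi>\<close> is transcendental over \<open>L\<close> and, more precisely, that
  the degree of \<open>A(\<phi>)\<close> as a rational function is \<open>n (deg Q - deg P)\<close>.
\<close>

lemma poly_at_quotient:
  fixes A P Q :: "'l::field poly"
  assumes "P \<noteq> 0" "degree P < degree Q" "A \<noteq> 0"
  shows "\<exists>c. c \<noteq> 0 \<and> degree c = degree A * degree Q \<and>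
    poly (map_poly (\<lambda>x. to_fract [:x:]) A) (- to_fract Q / to_fract P) * to_fract P ^ degree A = to_fract c"
  using assms(3)
proof (induction A)
  case (pCons a A)
  interpret cst: field_hom "\<lambda>x::'l. to_fract [:x:]" by (rule field_hom_constants)
  let ?ev = "\<lambda>A. poly (map_poly (\<lambda>x. to_fract [:x:]) A) (- to_fract Q / to_fract P)"
  have ev: "?ev (pCons a A) = to_fract [:a:] - to_fract Q / to_fract P * ?ev A"
    by (simp add: cst.map_poly_pCons_hom)
  show ?case
  proof (cases "A = 0")
    case True
    with pCons show ?thesis by (intro exI[of _ "[:a:]"]) (auto simp: cst.map_poly_pCons_hom)
  next
    case False
    from pCons.IH[OF this] obtain c where c: "c \<noteq> 0" "degree c = degree A * degree Q"
      "?ev A * to_fract P ^ degree A = to_fract c" by blast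
    let ?c = "smult a (P ^ Suc (degree A)) - Q * c"
    have Q0: "Q \<noteq> 0" using assms by auto
    have dQc: "degree (Q * c) = Suc (degree A) * degree Q"
      using Q0 c by (simp add: degree_mult_eq)
    have "degree (smult a (P ^ Suc (degree A))) \<le> degree (P ^ Suc (degree A))"
      by (rule degree_smult_le)
    also have "\<dots> \<le> Suc (degree A) * degree P"
      using degree_power_le[of P "Suc (degree A)"] by (simp only: mult.commute)
    also have "\<dots> < Suc (degree A) * degree Q" by (rule mult_strict_left_mono) (use assms(2) in auto)
    finally have lt: "degree (smult a (P ^ Suc (degree A))) < degree (Q * c)" using dQc by simp
    have d: "degree ?c = degree (Q * c)" using degree_add_eq_right[of "smult a (P ^ Suc (degree A))" "- (Q * c)"] lt
      by simp
    have "?ev (pCons a A) * to_fract P ^ Suc (degree A) =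
      to_fract [:a:] * to_fract P ^ Suc (degree A) - to_fract Q * (?ev A * to_fract P ^ degree A)"
      unfolding ev using assms(1) by (simp add: field_simps)
    also have "\<dots> = to_fract ([:a:] * P ^ Suc (degree A) - Q * c)"
      unfolding c(3) by (simp only: to_fract_power to_fract_mult to_fract_diff)
    finally have "?ev (pCons a A) * to_fract P ^ Suc (degree A) = to_fract ?c" by simp
    then show ?thesis using False d dQc lt by (intro exI[of _ ?c]) auto
  qed
qed simp

section \<open>Pencils of polynomials and Hilbert irreducibility\<close>

locale finite_extension_basis = field_extension hom
  for hom :: "'k::field \<Rightarrow> 'l::field" +
  fixes Bs :: "'l set"
  assumes finite_Bs: "finite Bs"
    and independent_Bs: "vs.independent Bs"
    and span_Bs: "vs.span Bs = UNIV"
begin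

lemma coordinates: obtains u where "x = (\<Sum>b\<in>Bs. hom (u b) * b)"
proof -
  have "x \<in> range (\<lambda>u. \<Sum>b\<in>Bs. hom (u b) * b)"
    using vs.span_finite[OF finite_Bs] span_Bs by auto
  with that show ?thesis by blast
qed

lemma algebraic_degree_le_card:
  obtains p where "p \<noteq> 0" "degree p \<le> card Bs" "eval_at p z = 0"
  using algebraic_of_powers_in_span[OF finite_Bs, of z] span_Bs by auto

text \<open>
  The target of the final contradiction: a polynomial that is irreducible over \<open>K\<close> and has a root in
  \<open>L\<close> cannot have degree greater than \<open>[L:K]\<close>.
\<close>

lemma irreducible_degree_le_card:
  assumes "irreducible g" "eval_at g z = 0"
  shows "degree g \<le> card Bs"
proof -
  obtain h where h: "h \<noteq> 0" "degree h \<le> card Bs" "eval_at h z = 0"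
    by (rule algebraic_degree_le_card)
  obtain m where m: "irreducible m" "\<And>h. eval_at h z = 0 \<Longrightarrow> m dvd h"
    using minimal_polynomial[OF h(1,3)] by metis
  from m(2)[OF assms(2)] obtain u where u: "g = m * u" by (elim dvdE)
  have g0: "g \<noteq> 0" using assms(1) by auto
  from u assms(1) m(1) have "is_unit u" by (metis irreducible_multD irreducible_not_unit)
  then have "degree g = degree m" using u g0 by (simp add: degree_mult_eq)
  also have "\<dots> \<le> degree h" using m(2)[OF h(3)] h(1) by (rule dvd_imp_degree_le)
  finally show ?thesis using h(2) by simp
qed

text \<open>
  The embedding of \<open>K(T)\<close> into \<open>L(X)\<close> with \<open>T \<mapsto> -Q/P\<close>. It makes \<open>X\<close> a root of \<open>Q + TP\<close>, so that this
  generic member of the pencil acquires its root inside a rational function field.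
\<close>

lemma function_field_embedding:
  assumes P0: "P \<noteq> 0" and deg: "degree P < degree Q"
  obtains j where "field_hom j"
    "\<And>a b. b \<noteq> 0 \<Longrightarrow> j (Fract a b) =
      poly (map_poly (\<lambda>k. to_fract [:hom k:]) a) (- to_fract Q / to_fract P) /
      poly (map_poly (\<lambda>k. to_fract [:hom k:]) b) (- to_fract Q / to_fract P)"
proof -
  let ?\<phi> = "- to_fract Q / to_fract P"
  interpret cst: field_hom "\<lambda>x::'l. to_fract [:x:]" by (rule field_hom_constants)
  interpret kc: field_hom "\<lambda>k. to_fract [:hom k:]"
    by unfold_locales (simp_all add: hom_add hom_mult flip: one_pCons to_fract_add to_fract_mult)
  interpret m: map_poly_inj_idom_hom "\<lambda>k. to_fract [:hom k:]" ..
  let ?h = "\<lambda>a. poly (map_poly (\<lambda>k. to_fract [:hom k:]) a) ?\<phi>"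
  have "inj_idom_hom ?h"
  proof
    show "?h 0 = 0" "?h 1 = 1" by simp_all
    show "?h (x + y) = ?h x + ?h y" for x y by (simp add: m.hom_add)
    show "?h (x * y) = ?h x * ?h y" for x y by (simp add: m.hom_mult)
    fix a assume a: "?h a = 0"
    have eq: "map_poly (\<lambda>k. to_fract [:hom k:]) a = map_poly (\<lambda>x. to_fract [:x:]) (map_poly hom a)"
      by (simp add: poly_eq_iff coeff_map_poly)
    show "a = 0"
    proof (rule ccontr)
      assume "a \<noteq> 0"
      then have "map_poly hom a \<noteq> 0" by simp
      from poly_at_quotient[OF P0 deg this] a show False unfolding eq by auto
    qed
  qed
  from fraction_field_hom_exists[OF this] that show ?thesis by blast
qed

end

locale pencil = finite_extension_basis hom Bs
  for hom :: "'k::field \<Rightarrow> 'l::field" and Bs +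
  fixes P Q :: "'l poly" and j :: "'k poly fract \<Rightarrow> 'l poly fract"
  assumes P_nonzero: "P \<noteq> 0" and degree_gap: "degree P + 2 \<le> degree Q"
    and field_hom_j: "field_hom j"
    and j_Fract: "\<And>a b. b \<noteq> 0 \<Longrightarrow> j (Fract a b) =
      poly (map_poly (\<lambda>k. to_fract [:hom k:]) a) (- to_fract Q / to_fract P) /
      poly (map_poly (\<lambda>k. to_fract [:hom k:]) b) (- to_fract Q / to_fract P)"
begin

sublocale E: field_extension j
  using field_hom_j by (simp add: field_extension_def)

sublocale cst: field_hom "\<lambda>x::'l. to_fract [:x:]" by (rule field_hom_constants)

abbreviation \<phi> :: "'l poly fract" where "\<phi> \<equiv> - to_fract Q / to_fract P"
abbreviation cst :: "'l \<Rightarrow> 'l poly fract" where "cst x \<equiv> to_fract [:x:]"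
abbreviation X :: "'l poly fract" where "X \<equiv> to_fract [:0, 1:]"

lemma deg: "degree P < degree Q" using degree_gap by simp

lemma j_to_fract: "j (to_fract a) = poly (map_poly cst (map_poly hom a)) \<phi>"
proof -
  have eq: "map_poly (\<lambda>k. to_fract [:hom k:]) a = map_poly cst (map_poly hom a)"
    by (simp add: poly_eq_iff coeff_map_poly)
  show ?thesis unfolding eq[symmetric] to_fract_def[of a] by (simp add: j_Fract)
qed

lemma j_constant: "j (to_fract [:k:]) = cst (hom k)"
  unfolding j_to_fract by (simp add: map_poly_pCons_hom cst.map_poly_pCons_hom)

lemma j_T: "j (to_fract [:0, 1:]) = \<phi>"
  unfolding j_to_fract by (simp add: map_poly_pCons_hom cst.map_poly_pCons_hom)

text \<open>
  Since \<open>Q = -\<phi> P\<close> with \<open>\<phi>\<close> in the image of \<open>K(T)\<close>, powers of \<open>X\<close> from \<open>deg Q\<close> on can be reduced to lower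
  ones. Together with a basis of \<open>L|K\<close> this leaves finitely many monomials, which span \<open>L(X)\<close> over
  \<open>K(T)\<close>.
\<close>

definition spanning :: "'l poly fract set" where
  "spanning = (\<lambda>(b, i). to_fract (monom b i)) ` (Bs \<times> {..<degree Q})"

lemma finite_spanning: "finite spanning" unfolding spanning_def using finite_Bs by simp

lemma to_fract_in_span: "to_fract p \<in> E.vs.span spanning"
proof (induction "degree p" arbitrary: p rule: less_induct)
  case less
  show ?case
  proof (cases "degree p < degree Q")
    case True
    have mon: "to_fract (monom x i) \<in> E.vs.span spanning" if i: "i < degree Q" for x i
    proof -
      obtain u where u: "x = (\<Sum>b\<in>Bs. hom (u b) * b)" by (rule coordinates)
      have "monom x i = (\<Sum>b\<in>Bs. [:hom (u b):] * monom b i)"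
        unfolding u by (simp add: monom_sum smult_monom)
      then have "to_fract (monom x i) = (\<Sum>b\<in>Bs. j (to_fract [:u b:]) * to_fract (monom b i))"
        by (simp only: j_constant to_fract_sum to_fract_mult)
      also have "\<dots> \<in> E.vs.span spanning"
        using i by (intro E.vs.span_sum E.vs.span_scale E.vs.span_base) (auto simp: spanning_def)
      finally show ?thesis .
    qed
    have "to_fract p = (\<Sum>i\<le>degree p. to_fract (monom (coeff p i) i))"
      by (simp flip: to_fract_sum add: poly_as_sum_of_monoms)
    also have "\<dots> \<in> E.vs.span spanning" using True by (intro E.vs.span_sum mon) auto
    finally show ?thesis .
  next
    case False
    have Q0: "Q \<noteq> 0" using deg by auto
    have p0: "p \<noteq> 0" using False deg by auto
    have d0: "p div Q \<noteq> 0" using False Q0 p0 by (simp add: div_poly_eq_0_iff)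
    have "degree (p div Q * Q) \<le> degree p"
    proof -
      have "p div Q * Q = p - p mod Q" by (simp add: minus_mod_eq_div_mult)
      moreover have "degree (p mod Q) \<le> degree p" using degree_mod_less'[of Q p] Q0 False
        by (cases "p mod Q = 0") auto
      ultimately show ?thesis by (metis degree_diff_le order_refl)
    qed
    then have "degree (p div Q * P) < degree p"
      using d0 Q0 P_nonzero deg by (simp add: degree_mult_eq)
    from less[OF this] have 1: "to_fract (p div Q * P) \<in> E.vs.span spanning" .
    have "degree (p mod Q) < degree p"
      using degree_mod_less'[of Q p] Q0 False deg by (cases "p mod Q = 0") auto
    from less[OF this] have 2: "to_fract (p mod Q) \<in> E.vs.span spanning" .
    have "p = p div Q * Q + p mod Q" by simp
    then have "to_fract p = to_fract (p div Q) * to_fract Q + to_fract (p mod Q)"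
      by (metis to_fract_add to_fract_mult)
    also have "\<dots> = j (- to_fract [:0, 1:]) * to_fract (p div Q * P) + to_fract (p mod Q)"
      using P_nonzero by (simp add: E.hom_uminus j_T)
    also have "\<dots> \<in> E.vs.span spanning" by (intro E.vs.span_add E.vs.span_scale 1 2)
    finally show ?thesis .
  qed
qed

text \<open>
  The span contains all polynomials, in particular the powers of a denominator \<open>b\<close>. So \<open>b\<close> is algebraic
  over \<open>K(T)\<close>, its inverse is a polynomial in \<open>b\<close>, and no new elements arise from fractions.
\<close>

lemma span_spanning: "e \<in> E.vs.span spanning"
proof -
  obtain a b where ab: "e = Fract a b" "b \<noteq> 0" by (cases e)
  have "\<exists>p. p \<noteq> 0 \<and> E.eval_at p (to_fract b) = 0"
    using E.algebraic_of_powers_in_span[OF finite_spanning, of "to_fract b"] to_fract_in_span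
    by (metis to_fract_power)
  then obtain p where "p \<noteq> 0" "E.eval_at p (to_fract b) = 0" by blast
  from E.inverse_in_adjoin[OF this] obtain r where r: "inverse (to_fract b) = E.eval_at r (to_fract b)"
    by (auto simp: E.adjoin_def)
  have "e = to_fract a * E.eval_at r (to_fract b)"
    by (simp add: ab Fract_conv_to_fract divide_inverse r)
  also have "\<dots> = (\<Sum>i\<le>degree r. j (coeff r i) * to_fract (a * b ^ i))"
    unfolding poly_altdef by (simp add: sum_distrib_left to_fract_power ac_simps)
  also have "\<dots> \<in> E.vs.span spanning" by (intro E.vs.span_sum E.vs.span_scale to_fract_in_span)
  finally show ?thesis .
qed

lemma E_algebraic: "\<exists>q. q \<noteq> 0 \<and> E.eval_at q e = 0"
  using E.algebraic_of_powers_in_span[OF finite_spanning span_spanning] by metis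

text \<open>
  A lower bound for the degree of \<open>L(X)\<close> over \<open>K(T)\<close>. As rational functions in \<open>X\<close>, the nonzero elements
  of \<open>L(\<phi>)\<close> have degrees divisible by \<open>deg Q - deg P\<close>, which is at least \<open>2\<close>, while \<open>X\<close> has degree \<open>1\<close>.
  Hence \<open>X\<close> is independent of the basis of \<open>L\<close>, which itself stays independent because \<open>\<phi>\<close> is
  transcendental over \<open>L\<close>.
\<close>

lemma independent_constants_X:
  shows "X \<notin> cst ` Bs" "E.vs.independent (insert X (cst ` Bs))"
proof -
  show X: "X \<notin> cst ` Bs" by auto
  let ?T = "insert X (cst ` Bs)"
  show "E.vs.independent ?T"
  proof (rule E.vs.independent_if_scalars_zero)
    show fin: "finite ?T" using finite_Bs by simp
    fix f x assume f: "(\<Sum>x\<in>?T. j (f x) * x) = 0" and x: "x \<in> ?T"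
    obtain D m where D: "D \<noteq> 0" and m: "\<And>x. x \<in> ?T \<Longrightarrow> to_fract D * f x = to_fract (m x)"
      using fract_common_denominator[OF fin] by metis
    have inj: "inj_on cst Bs" by (auto simp: inj_on_def)
    define A where "A = (\<Sum>b\<in>Bs. smult b (map_poly hom (m (cst b))))"
    have "0 = j (to_fract D) * (\<Sum>x\<in>?T. j (f x) * x)" using f by simp
    also have "\<dots> = (\<Sum>x\<in>?T. j (to_fract (m x)) * x)"
      unfolding sum_distrib_left by (intro sum.cong) (simp_all add: m[symmetric] E.hom_mult)
    also have "\<dots> = j (to_fract (m X)) * X + (\<Sum>b\<in>Bs. j (to_fract (m (cst b))) * cst b)"
      using X finite_Bs by (simp add: sum.reindex[OF inj])
    also have "(\<Sum>b\<in>Bs. j (to_fract (m (cst b))) * cst b) = poly (map_poly cst A) \<phi>"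
    proof -
      interpret c: map_poly_inj_idom_hom cst ..
      show ?thesis
        by (simp add: A_def j_to_fract c.hom_sum poly_sum cst.map_poly_hom_smult mult.commute)
    qed
    finally have eq: "j (to_fract (m X)) * X + poly (map_poly cst A) \<phi> = 0" by simp
    have mX: "m X = 0"
    proof (rule ccontr)
      assume nz: "m X \<noteq> 0"
      then have M0: "map_poly hom (m X) \<noteq> 0" by simp
      have "j (to_fract (m X)) \<noteq> 0" using nz by simp
      then have "A \<noteq> 0" using eq by auto
      let ?n = "degree A" and ?n' = "degree (map_poly hom (m X))"
      from poly_at_quotient[OF P_nonzero deg \<open>A \<noteq> 0\<close>] obtain c where c: "c \<noteq> 0"
        "degree c = ?n * degree Q" "poly (map_poly cst A) \<phi> * to_fract P ^ ?n = to_fract c"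
        by blast
      \<comment> \<open>A relation \<open>m(\<phi>) X + A(\<phi>) = 0\<close> forces the degrees of both terms to agree.\<close>
      from poly_at_quotient[OF P_nonzero deg M0] obtain c' where c': "c' \<noteq> 0"
        "degree c' = ?n' * degree Q" "j (to_fract (m X)) * to_fract P ^ ?n' = to_fract c'"
        unfolding j_to_fract by blast
      have "0 = (j (to_fract (m X)) * X + poly (map_poly cst A) \<phi>) * to_fract P ^ ?n * to_fract P ^ ?n'"
        using eq by simp
      also have "\<dots> = to_fract (c' * [:0, 1:] * P ^ ?n + c * P ^ ?n')"
        unfolding to_fract_add to_fract_mult to_fract_power c(3)[symmetric] c'(3)[symmetric]
        by (simp only: algebra_simps)
      finally have "c' * [:0, 1:] * P ^ ?n + c * P ^ ?n' = 0" by (metis to_fract_eq_0_iff)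
      then have "c' * [:0, 1:] * P ^ ?n = - (c * P ^ ?n')" by (simp add: eq_neg_iff_add_eq_0)
      then have "degree (c' * [:0, 1:] * P ^ ?n) = degree (c * P ^ ?n')" by simp
      then have "?n' * degree Q + 1 + ?n * degree P = ?n * degree Q + ?n' * degree P"
        using c c' P_nonzero by (simp add: degree_mult_eq degree_power_eq ac_simps)
      moreover obtain D where D: "degree Q = degree P + D" "D \<ge> 2"
        using degree_gap by (metis add.assoc le_Suc_ex le_add1)
      ultimately have "?n * D = ?n' * D + 1" by (simp add: algebra_simps)
      then have "D dvd ?n' * D + 1" by (metis dvd_triv_right)
      then have "D dvd 1" by (metis dvd_add_right_iff dvd_triv_right)
      with D(2) show False by simp
    qed
    then have "poly (map_poly cst A) \<phi> = 0" using eq by simp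
    with poly_at_quotient[OF P_nonzero deg, of A] have "A = 0" by auto
    have "m (cst b) = 0" if b: "b \<in> Bs" for b
    proof -
      have "coeff (m (cst b)) i = 0" for i
      proof -
        have "(\<Sum>b\<in>Bs. hom (coeff (m (cst b)) i) * b) = coeff A i"
          by (simp add: A_def coeff_sum mult.commute)
        then have "(\<Sum>b\<in>Bs. hom (coeff (m (cst b)) i) * b) = 0" using \<open>A = 0\<close> by simp
        from vs.independentD[OF independent_Bs finite_Bs order_refl this b] show ?thesis .
      qed
      then show ?thesis by (simp add: poly_eq_iff)
    qed
    with mX x have "m x = 0" by auto
    with m[OF x] D show "f x = 0" by auto
  qed
qed

end

context pencil
begin

text \<open>
  Enlarging the field generated by a translate of \<open>X\<close>: the coefficient supplied by the primitive element
  theorem can be taken in \<open>K\<close>, so the new generator is again a translate of \<open>X\<close> by an element of \<open>L\<close>.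
  It is important to stay with translates, because their values at a point are under control.
\<close>

lemma generator_step:
  assumes inf: "infinite (UNIV :: 'k set)" and sep: "separable_element hom \<beta>"
  obtains k where
    "cst \<beta> \<in> E.adjoin (X + cst (\<alpha> + hom k * \<beta>))"
    "E.adjoin (X + cst \<alpha>) \<subseteq> E.adjoin (X + cst (\<alpha> + hom k * \<beta>))"
proof -
  obtain p where p: "irreducible p" "eval_at p \<beta> = 0" "coprime p (pderiv p)"
    using sep by (auto simp: separable_element_def)
  let ?c = "\<lambda>k :: 'k. to_fract [:k:]"
  interpret c: field_hom ?c by (rule field_hom_constants)
  interpret mc: map_poly_inj_idom_hom ?c ..
  have ev: "E.eval_at (map_poly ?c r) (cst \<beta>) = cst (eval_at r \<beta>)" for r
  proof -
    have "map_poly j (map_poly ?c r) = map_poly cst (map_poly hom r)"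
      by (simp add: poly_eq_iff j_constant)
    then show ?thesis by simp
  qed
  let ?S = "range ?c"
  have "inj ?c" by (simp add: inj_on_def)
  with inf have S: "infinite ?S" by (simp add: finite_image_iff)
  have p1: "E.eval_at (map_poly ?c p) (cst \<beta>) = 0" unfolding ev p(2) by simp
  have "E.eval_at (map_poly ?c (pderiv p)) (cst \<beta>) \<noteq> 0"
    unfolding ev using separable_simple_root[OF p] by simp
  then have p2: "E.eval_at (pderiv (map_poly ?c p)) (cst \<beta>) \<noteq> 0" by (simp add: c.map_poly_pderiv)
  obtain s where s: "s \<in> ?S" "cst \<beta> \<in> E.adjoin (X + cst \<alpha> + j s * cst \<beta>)"
    by (rule E.primitive_element[OF E_algebraic S p1 p2])
  then obtain k where k: "s = ?c k" by blast
  let ?\<delta> = "X + cst (\<alpha> + hom k * \<beta>)"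
  have eq: "X + cst \<alpha> + j s * cst \<beta> = ?\<delta>"
    unfolding k j_constant by (simp add: cst.hom_add cst.hom_mult)
  have \<beta>: "cst \<beta> \<in> E.adjoin ?\<delta>" using s(2) unfolding eq .
  have "?\<delta> - j s * cst \<beta> \<in> E.adjoin ?\<delta>"
    by (intro E.adjoin_diff E.adjoin_mult E.adjoin_hom E.adjoin_self \<beta>)
  then have "X + cst \<alpha> \<in> E.adjoin ?\<delta>" unfolding eq[symmetric] by simp
  with \<beta> that E.adjoin_subset show ?thesis by blast
qed

lemma primitive_translate:
  assumes inf: "infinite (UNIV :: 'k set)" and sep: "separable_extension hom"
  obtains \<alpha> where "insert X (cst ` Bs) \<subseteq> E.adjoin (X + cst \<alpha>)"
proof -
  have "\<exists>\<alpha>. cst ` C \<subseteq> E.adjoin (X + cst \<alpha>)" if "finite C" for C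
    using that
  proof induction
    case (insert \<beta> C)
    then obtain \<alpha> where \<alpha>: "cst ` C \<subseteq> E.adjoin (X + cst \<alpha>)" by blast
    have "separable_element hom \<beta>" using sep by (simp add: separable_extension_def)
    then obtain k where k: "cst \<beta> \<in> E.adjoin (X + cst (\<alpha> + hom k * \<beta>))"
      "E.adjoin (X + cst \<alpha>) \<subseteq> E.adjoin (X + cst (\<alpha> + hom k * \<beta>))"
      by (rule generator_step[OF inf])
    with \<alpha> have "cst ` insert \<beta> C \<subseteq> E.adjoin (X + cst (\<alpha> + hom k * \<beta>))" by auto
    then show ?case by (rule exI)
  qed simp
  from this[OF finite_Bs] obtain \<alpha> where \<alpha>: "cst ` Bs \<subseteq> E.adjoin (X + cst \<alpha>)" by blast
  obtain u where u: "\<alpha> = (\<Sum>b\<in>Bs. hom (u b) * b)" by (rule coordinates)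
  have sum: "(\<Sum>b\<in>A. f b) \<in> E.adjoin z" if "\<And>b. b \<in> A \<Longrightarrow> f b \<in> E.adjoin z"
    for A :: "'l set" and f z
    using that E.adjoin_hom[of 0]
    by (induction A rule: infinite_finite_induct) (auto intro: E.adjoin_add)
  have "cst \<alpha> = (\<Sum>b\<in>Bs. j (to_fract [:u b:]) * cst b)"
    unfolding u by (simp add: cst.hom_sum cst.hom_mult j_constant)
  also have "\<dots> \<in> E.adjoin (X + cst \<alpha>)"
    using \<alpha> by (intro sum E.adjoin_mult E.adjoin_hom) auto
  finally have "(X + cst \<alpha>) - cst \<alpha> \<in> E.adjoin (X + cst \<alpha>)"
    by (intro E.adjoin_diff E.adjoin_self)
  with \<alpha> that show ?thesis by simp
qed

text \<open>
  Translates of \<open>X\<close> exist that generate a space containing \<open>[L:K] + 1\<close> independent elements. Such a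
  bound is not available for \<open>X\<close> itself: if \<open>P\<close> and \<open>Q\<close> have coefficients in \<open>K\<close>, for instance, the degree
  of \<open>X\<close> is at most \<open>deg Q\<close>, however large \<open>[L:K]\<close> is.
\<close>

lemma high_degree_translate:
  assumes inf: "infinite (UNIV :: 'k set)" and sep: "separable_extension hom"
  obtains \<alpha> G where "irreducible G" "lead_coeff G = 1" "E.eval_at G (X + cst \<alpha>) = 0"
    "card Bs < degree G"
proof -
  obtain \<alpha> where \<alpha>: "insert X (cst ` Bs) \<subseteq> E.adjoin (X + cst \<alpha>)"
    by (rule primitive_translate[OF assms])
  obtain q where q: "q \<noteq> 0" "E.eval_at q (X + cst \<alpha>) = 0" using E_algebraic by blast
  obtain G where G: "lead_coeff G = 1" "irreducible G" "E.eval_at G (X + cst \<alpha>) = 0"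
    using E.minimal_polynomial[OF q] by metis
  from G(2) have "G \<noteq> 0" by auto
  let ?T = "(\<lambda>i. (X + cst \<alpha>) ^ i) ` {..<degree G}"
  have "insert X (cst ` Bs) \<subseteq> E.vs.span ?T"
    using \<alpha> E.adjoin_subset_span_powers[OF \<open>G \<noteq> 0\<close> G(3)] by blast
  from E.vs.independent_span_bound[OF _ independent_constants_X(2) this]
  have "card (insert X (cst ` Bs)) \<le> card ?T" by simp
  also have "\<dots> \<le> degree G" by (metis card_image_le card_lessThan finite_lessThan)
  also have "card (insert X (cst ` Bs)) = Suc (card Bs)"
  proof -
    have "card (cst ` Bs) = card Bs" by (rule card_image) (simp add: inj_on_def)
    then show ?thesis using independent_constants_X(1) finite_Bs by simp
  qed
  finally show ?thesis using G that by (simp add: Suc_le_eq)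
qed

text \<open>
  If \<open>x\<close> is a root of \<open>Q + tP\<close>, then evaluating at \<open>X = x\<close> extends evaluating at \<open>T = t\<close>, because \<open>-Q/P\<close>
  takes the value \<open>t\<close> at \<open>x\<close>.
\<close>

lemma value_at_j:
  assumes x: "poly P x \<noteq> 0" "poly Q x + hom t * poly P x = 0" and e: "defined_at e t"
  shows "defined_at (j e) x \<and> value_at (j e) x = hom (value_at e t)"
proof -
  have \<phi>: "defined_at \<phi> x \<and> value_at \<phi> x = hom t"
  proof -
    have "\<phi> = Fract (- Q) P" by (simp add: Fract_conv_to_fract)
    moreover have "- poly Q x = hom t * poly P x" using x(2) by (simp add: neg_eq_iff_add_eq_0)
    ultimately show ?thesis
      using value_at_Fract[OF x(1), of "- Q"] defined_at_Fract[OF x(1), of "- Q"] x(1) by simp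
  qed
  have ev: "defined_at (j (to_fract a)) x \<and> value_at (j (to_fract a)) x = hom (poly a t)" for a
  proof -
    have "specialize (map_poly cst (map_poly hom a)) x = map_poly hom a"
      by (simp add: poly_eq_iff coeff_specialize value_at_to_fract)
    then show ?thesis
      using value_at_poly[of "map_poly cst (map_poly hom a)" x \<phi>] \<phi>
      unfolding j_to_fract by (simp add: defined_at_to_fract)
  qed
  obtain n d where nd: "e = Fract n d" "poly d t \<noteq> 0" "d \<noteq> 0" "value_at e t = poly n t / poly d t"
    using e by (rule defined_at_cases)
  have "j e = j (to_fract n) * inverse (j (to_fract d))"
    unfolding nd(1) Fract_conv_to_fract by (simp add: divide_inverse E.hom_mult E.hom_inverse)
  moreover have "value_at (j (to_fract d)) x \<noteq> 0" using ev[of d] nd(2) by simp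
  ultimately show ?thesis
    using value_at_inverse[of "j (to_fract d)" x] ev[of d] ev[of n]
      value_at_mult[of "j (to_fract n)" x "inverse (j (to_fract d))"]
    by (simp add: nd(4) hom_mult hom_inverse divide_inverse)
qed

end

context finite_extension_basis
begin

text \<open>
  Without a common root, every root \<open>x\<close> of \<open>Q + tP\<close> is a point where \<open>-Q/P\<close> is defined, so the minimal
  polynomial of \<open>X + \<alpha>\<close> specialises at \<open>T = t\<close> to a polynomial with root \<open>x + \<alpha>\<close>. For a good \<open>t\<close> it is
  irreducible, but its degree is too large for a root in \<open>L\<close>.
\<close>

lemma common_root_if_pencil_has_roots:
  assumes hil: "hilbertian TYPE('k)" and sep: "separable_extension hom"
    and P0: "P \<noteq> 0" and gap: "degree P + 2 \<le> degree Q"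
    and roots: "\<And>t. \<exists>x. poly (Q + smult (hom t) P) x = 0"
  shows "\<exists>x. poly P x = 0 \<and> poly Q x = 0"
proof (rule ccontr)
  assume no: "\<not> ?thesis"
  have inf: "infinite (UNIV :: 'k set)"
    using hil[unfolded hilbertian_def, rule_format, of "{}"] by simp
  have "degree P < degree Q" using gap by simp
  from function_field_embedding[OF P0 this]
  obtain j where j: "field_hom j" "\<And>a b. b \<noteq> 0 \<Longrightarrow> j (Fract a b) =
      poly (map_poly (\<lambda>k. to_fract [:hom k:]) a) (- to_fract Q / to_fract P) /
      poly (map_poly (\<lambda>k. to_fract [:hom k:]) b) (- to_fract Q / to_fract P)" by blast
  then interpret pencil hom Bs P Q j using P0 gap 
    by (intro pencil.intro pencil_axioms.intro finite_extension_basis_axioms P0 gap j)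
  obtain \<alpha> G where G: "irreducible G" "lead_coeff G = 1" "E.eval_at G (X + cst \<alpha>) = 0"
    "card Bs < degree G" by (rule high_degree_translate[OF inf sep])
  have "infinite {t. \<forall>f\<in>{G}. (\<forall>i. defined_at (coeff f i) t) \<and> irreducible (specialize f t)}"
    using hil G(1) unfolding hilbertian_def by blast
  then obtain t where t: "\<And>i. defined_at (coeff G i) t" "irreducible (specialize G t)"
    by (metis (no_types, lifting) empty_Collect_eq finite.emptyI singletonI)
  obtain x where x: "poly (Q + smult (hom t) P) x = 0" using roots by blast
  have Px: "poly P x \<noteq> 0"
  proof
    assume "poly P x = 0"
    with x have "poly Q x = 0" by simp
    with no \<open>poly P x = 0\<close> show False by blast
  qed
  from x have x': "poly Q x + hom t * poly P x = 0" by simp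
  have sp: "specialize (map_poly j G) x = map_poly hom (specialize G t)"
    using value_at_j[OF Px x' t(1)] by (simp add: poly_eq_iff coeff_specialize)
  have d: "defined_at (X + cst \<alpha>) x" by (simp add: defined_at_to_fract flip: to_fract_add)
  have "value_at (E.eval_at G (X + cst \<alpha>)) x =
      eval_at (specialize G t) (value_at (X + cst \<alpha>) x)"
    using value_at_poly[of "map_poly j G" x, OF _ d] value_at_j[OF Px x' t(1)] by (simp add: sp)
  then have root: "eval_at (specialize G t) (value_at (X + cst \<alpha>) x) = 0"
    using value_at_to_fract[of 0 x] by (simp add: G(3))
  have "coeff (specialize G t) (degree G) = 1"
    using G(2) value_at_to_fract[of 1 t] by (simp add: coeff_specialize)
  then have "degree G \<le> degree (specialize G t)" by (intro le_degree) simp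
  with irreducible_degree_le_card[OF t(2) root] G(4) show False by simp
qed

end

section \<open>Linear spaces of polynomials with roots\<close>

text \<open>
  For \<open>w\<close> in one of the subspaces \<open>U\<^sub>i\<close> and \<open>v\<close> outside it, the points of the line \<open>v + k w\<close> all avoid \<open>U\<^sub>i\<close>.
  The line is infinite, so one of the other subspaces contains two of its points and hence \<open>w\<close>.
\<close>

lemma (in vector_space) subspace_covered_by_finitely_many:
  assumes inf: "infinite (UNIV :: 'a set)" and "finite I"
    and U: "\<And>i. i \<in> I \<Longrightarrow> subspace (U i)" and V: "subspace V"
    and "V \<subseteq> (\<Union>i\<in>I. U i)"
  shows "\<exists>i\<in>I. V \<subseteq> U i"
  using assms(2,3,5)
proof (induction I)
  case empty
  with subspace_0[OF V] show ?case by auto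
next
  case (insert i I)
  have Ui: "subspace (U i)" and UI: "\<And>i'. i' \<in> I \<Longrightarrow> subspace (U i')" using insert.prems(1) by auto
  consider "V \<subseteq> U i" | "V \<subseteq> (\<Union>i\<in>I. U i)" | v w where "v \<in> V" "v \<notin> U i" "w \<in> V" "w \<notin> (\<Union>i\<in>I. U i)"
    by blast
  then show ?case
  proof cases
    case 1
    then show ?thesis by blast
  next
    case 2
    from insert.IH[OF UI this] show ?thesis by blast
  next
    case (3 v w)
    then have wi: "w \<in> U i" using insert.prems(2) by auto
    have "\<exists>i'\<in>I. v + k *s w \<in> U i'" for k
    proof -
      have "v + k *s w \<in> V" using 3 V by (simp add: subspace_add subspace_scale)
      moreover have "v + k *s w \<notin> U i"
      proof
        assume "v + k *s w \<in> U i"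
        then have "(v + k *s w) - k *s w \<in> U i" by (intro subspace_diff[OF Ui] subspace_scale[OF Ui] wi)
        with 3 show False by simp
      qed
      ultimately show ?thesis using insert.prems(2) by auto
    qed
    then obtain c where c: "\<And>k. c k \<in> I" "\<And>k. v + k *s w \<in> U (c k)" by metis
    have "finite (range c)" using c(1) insert.hyps(1) by (meson finite_subset image_subsetI)
    then have "\<not> inj c" using inf finite_imageD by blast
    then obtain k k' where k: "k \<noteq> k'" "c k = c k'" by (auto simp: inj_def)
    have "(v + k *s w) - (v + k' *s w) \<in> U (c k)"
      using c(2)[of k] c(2)[of k'] unfolding k(2) by (intro subspace_diff UI c(1))
    moreover have "(v + k *s w) - (v + k' *s w) = (k - k') *s w" by (simp add: scale_left_diff_distrib)
    ultimately have "inverse (k - k') *s ((k - k') *s w) \<in> U (c k)"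
      by (metis subspace_scale UI c(1))
    then have "w \<in> U (c k)" using k(1) by simp
    with 3 c(1) show ?thesis by blast
  qed
qed

context field_extension
begin

sublocale px: vector_space "\<lambda>k. smult (hom k)"
  by unfold_locales (auto simp: smult_add_right smult_add_left hom_add hom_mult)

lemma root_preservers_iff:
  "f \<in> root_preservers hom \<longleftrightarrow>
    (\<forall>p q. f (p + q) = f p + f q) \<and> (\<forall>k p. f (smult (hom k) p) = smult (hom k) (f p)) \<and> bij f \<and>
    (\<forall>p. (\<exists>x. poly (f p) x = 0) \<longleftrightarrow> (\<exists>x. poly p x = 0))"
proof -
  have img: "f ` polys_with_root = polys_with_root \<longleftrightarrow>
      (\<forall>p. (\<exists>x. poly (f p) x = 0) \<longleftrightarrow> (\<exists>x. poly p x = 0))" if b: "bij f"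
  proof -
    have "f ` polys_with_root = polys_with_root \<longleftrightarrow> (\<forall>p. f p \<in> polys_with_root \<longleftrightarrow> p \<in> polys_with_root)"
    proof
      assume eq: "f ` polys_with_root = polys_with_root"
      show "\<forall>p. f p \<in> polys_with_root \<longleftrightarrow> p \<in> polys_with_root"
        using inj_image_mem_iff[OF bij_is_inj[OF b], of _ polys_with_root] unfolding eq by blast
    next
      assume r: "\<forall>p. f p \<in> polys_with_root \<longleftrightarrow> p \<in> polys_with_root"
      show "f ` polys_with_root = polys_with_root"
      proof
        show "f ` polys_with_root \<subseteq> polys_with_root" using r by blast
        show "polys_with_root \<subseteq> f ` polys_with_root"
        proof
          fix q assume q: "q \<in> (polys_with_root :: 'e poly set)"
          obtain p where "q = f p" using b by (metis bij_pointE)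
          with q r show "q \<in> f ` polys_with_root" by blast
        qed
      qed
    qed
    then show ?thesis by (simp add: polys_with_root_def)
  qed
  have lin: "Vector_Spaces.linear (\<lambda>k. smult (hom k)) (\<lambda>k. smult (hom k)) f \<longleftrightarrow>
     (\<forall>p q. f (p + q) = f p + f q) \<and> (\<forall>k p. f (smult (hom k) p) = smult (hom k) (f p))"
    unfolding Vector_Spaces.linear_iff using px.vector_space_axioms by blast
  show ?thesis unfolding root_preservers_def mem_Collect_eq lin
    by (cases "bij f") (simp_all only: img simp_thms conj_assoc)
qed

lemma root_preservers_inv:
  assumes "f \<in> root_preservers hom"
  shows "inv_into UNIV f \<in> root_preservers hom"
proof -
  note f = assms[unfolded root_preservers_iff]
  then have b: "bij f" by blast
  have fi: "f (inv_into UNIV f p) = p" for p using b by (simp add: bij_is_surj surj_f_inv_f)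
  have if': "inv_into UNIV f (f p) = p" for p using b by (simp add: bij_is_inj)
  show ?thesis
    unfolding root_preservers_iff
  proof (intro conjI allI)
    show "inv_into UNIV f (p + q) = inv_into UNIV f p + inv_into UNIV f q" for p q
      using f by (metis fi if')
    show "inv_into UNIV f (smult (hom k) p) = smult (hom k) (inv_into UNIV f p)" for k p
      using f by (metis fi if')
    show "bij (inv_into UNIV f)" using b by (rule bij_imp_bij_inv)
    show "(\<exists>x. poly (inv_into UNIV f p) x = 0) \<longleftrightarrow> (\<exists>x. poly p x = 0)" for p
      using f by (metis fi)
  qed
qed

end

context finite_extension_basis
begin

text \<open>
  Fix a nonconstant \<open>P\<close> in the space. Every element of large degree has a root in common with \<open>P\<close>,
  and \<open>P\<close> has finitely many roots, so finitely many subspaces cover everything. The subspace of polynomials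
  of small degree is proper by the assumption of unbounded degrees.
\<close>

lemma root_subspace_has_common_root:
  assumes hil: "hilbertian TYPE('k)" and sep: "separable_extension hom"
    and V: "px.subspace V" and roots: "\<And>p. p \<in> V \<Longrightarrow> \<exists>x. poly p x = 0"
    and large: "\<And>n. \<exists>p\<in>V. n < degree p"
  shows "\<exists>y. \<forall>p\<in>V. poly p y = 0"
proof -
  have inf: "infinite (UNIV :: 'k set)"
    using hil[unfolded hilbertian_def, rule_format, of "{}"] by simp
  obtain P where P: "P \<in> V" "degree P > 0" using large by blast
  then have P0: "P \<noteq> 0" by auto
  let ?I = "insert None (Some ` {y. poly P y = 0})"
  \<comment> \<open>The index \<open>None\<close> stands for the polynomials of small degree, \<open>Some y\<close> for those vanishing at \<open>y\<close>.\<close>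
  let ?U = "\<lambda>i. case i of None \<Rightarrow> {p. degree p \<le> degree P + 1} | Some y \<Rightarrow> {p. poly p y = 0}"
  have fin: "finite ?I" using poly_roots_finite[OF P0] by simp
  have U: "px.subspace (?U i)" for i
    by (cases i) (auto intro!: px.subspaceI degree_add_le order_trans[OF degree_smult_le])
  have cover: "V \<subseteq> (\<Union>i\<in>?I. ?U i)"
  proof
    fix Q assume Q: "Q \<in> V"
    show "Q \<in> (\<Union>i\<in>?I. ?U i)"
    proof (cases "degree Q \<le> degree P + 1")
      case True
      then show ?thesis by auto
    next
      case False
      have "\<exists>x. poly (Q + smult (hom t) P) x = 0" for t
        by (intro roots px.subspace_add[OF V] px.subspace_scale[OF V] P Q)
      from common_root_if_pencil_has_roots[OF hil sep P0 _ this] False show ?thesis by auto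
    qed
  qed
  from px.subspace_covered_by_finitely_many[OF inf fin U V cover]
  obtain i where i: "i \<in> ?I" "V \<subseteq> ?U i" by blast
  show ?thesis
  proof (cases i)
    case None
    with i(2) large[of "degree P + 1"] show ?thesis by auto
  next
    case (Some y)
    with i(2) show ?thesis by auto
  qed
qed

text \<open>
  The constants form a finite-dimensional \<open>K\<close>-space, and so does their image.
\<close>

lemma bounded_degree_on_constants:
  assumes add: "\<And>p q. f (p + q) = f p + f q"
    and scale: "\<And>k p. f (smult (hom k) p) = smult (hom k) (f p)"
  obtains N where "\<And>u. degree (f [:u:] :: 'l poly) \<le> N"
proof -
  define N where "N = Max (insert 0 ((\<lambda>b. degree (f [:b:])) ` Bs))"
  have "degree (f [:u:]) \<le> N" for u
  proof -
    have f0: "f 0 = 0" using scale[of 0 0] by simp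
    obtain a where a: "u = (\<Sum>b\<in>Bs. hom (a b) * b)" by (rule coordinates)
    have sum: "f (\<Sum>b\<in>A. g b) = (\<Sum>b\<in>A. f (g b))" for A :: "'l set" and g
      by (induction A rule: infinite_finite_induct) (simp_all add: f0 add)
    have c: "[:u:] = (\<Sum>b\<in>Bs. smult (hom (a b)) [:b:])"
      unfolding a by (simp add: poly_eq_iff coeff_sum coeff_pCons split: nat.splits)
    have "f [:u:] = (\<Sum>b\<in>Bs. smult (hom (a b)) (f [:b:]))"
      unfolding c sum scale ..
    also have "degree \<dots> \<le> N"
    proof (rule degree_sum_le[OF finite_Bs])
      fix b assume "b \<in> Bs"
      then have "degree (f [:b:]) \<le> N" unfolding N_def using finite_Bs by (intro Max_ge) auto
      then show "degree (smult (hom (a b)) (f [:b:])) \<le> N" using degree_smult_le order_trans by blast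
    qed
    finally show ?thesis .
  qed
  with that show ?thesis by blast
qed

text \<open>
  The image of the polynomials vanishing at \<open>x\<close> contains polynomials of arbitrarily large degree: a
  preimage of \<open>X\<^sup>n\<close> can be made to vanish at \<open>x\<close> by subtracting a constant, which changes the image by a
  polynomial of bounded degree.
\<close>

lemma root_preserver_moves_points:
  assumes hil: "hilbertian TYPE('k)" and sep: "separable_extension hom"
    and f: "f \<in> root_preservers hom"
  shows "\<exists>y. \<forall>p. poly p x = 0 \<longrightarrow> poly (f p) y = 0"
proof -
  note f' = f[unfolded root_preservers_iff]
  have add: "\<And>p q. f (p + q) = f p + f q" and scale: "\<And>k p. f (smult (hom k) p) = smult (hom k) (f p)"
    and bij: "bij f" and roots: "\<And>p. (\<exists>x. poly (f p) x = 0) \<longleftrightarrow> (\<exists>x. poly p x = 0)"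
    using f' by blast+
  have f0: "f 0 = 0" using scale[of 0 0] by simp
  have diff: "f (p - q) = f p - f q" for p q
    using add[of "p - q" q] by (simp add: algebra_simps)
  let ?V = "f ` {p. poly p x = 0}"
  have V: "px.subspace ?V"
  proof (rule px.subspaceI)
    show "0 \<in> ?V" using f0 by (intro image_eqI[of _ _ 0]) auto
    show "a + b \<in> ?V" if ab: "a \<in> ?V" "b \<in> ?V" for a b
    proof -
      from ab obtain p q where "a = f p" "poly p x = 0" "b = f q" "poly q x = 0" by blast
      then show ?thesis by (intro image_eqI[of _ _ "p + q"]) (auto simp: add)
    qed
    show "smult (hom k) a \<in> ?V" if a: "a \<in> ?V" for k a
    proof -
      from a obtain p where "a = f p" "poly p x = 0" by blast
      then show ?thesis by (intro image_eqI[of _ _ "smult (hom k) p"]) (auto simp: scale)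
    qed
  qed
  obtain N where N: "\<And>u. degree (f [:u:]) \<le> N"
    using bounded_degree_on_constants[of f] add scale by metis
  have large: "\<exists>p\<in>?V. n < degree p" for n
  proof -
    obtain p where p: "f p = monom 1 (N + n + 1)" using bij by (metis bij_pointE)
    have "degree (- f [:poly p x:]) < degree (f p)" using N[of "poly p x"] by (simp add: p degree_monom_eq)
    from degree_add_eq_left[OF this] have "degree (f p - f [:poly p x:]) = N + n + 1"
      by (simp add: p degree_monom_eq)
    then have "n < degree (f (p - [:poly p x:]))" by (simp add: diff)
    then show ?thesis by (intro bexI[of _ "f (p - [:poly p x:])"]) auto
  qed
  have "\<exists>z. poly q z = 0" if "q \<in> ?V" for q using that roots by auto
  from root_subspace_has_common_root[OF hil sep V this large] show ?thesis by auto
qed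

end

section \<open>Maps that move evaluation kernels\<close>

text \<open>
  Polynomial rings over fields are completely integrally closed: if the powers of \<open>r/g\<close> have the common
  denominator \<open>c\<close>, then \<open>r/g\<close> is a polynomial. The factor \<open>c\<close> also makes the induction work, because
  cancelling an irreducible factor from both \<open>g\<close> and \<open>r\<close> leaves the hypothesis intact.
\<close>

lemma power_dvd_imp_dvd:
  fixes g r c :: "'a::field poly"
  assumes "g \<noteq> 0" "c \<noteq> 0" "\<And>n. g ^ n dvd c * r ^ n"
  shows "g dvd r"
  using assms(1,3)
proof (induction "degree g" arbitrary: g r rule: less_induct)
  case less
  show ?case
  proof (cases "degree g = 0")
    case True
    with less.prems(1) have "is_unit g" by simp
    then show ?thesis by (rule unit_imp_dvd)
  next
    case False
    then obtain \<pi> g' where \<pi>: "irreducible \<pi>" "g = \<pi> * g'" using irreducible_monic_factor[of g] by auto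
    have prime: "prime_elem \<pi>" using field_poly_irreducible_imp_prime[OF \<pi>(1)] .
    have \<pi>0: "\<pi> \<noteq> 0" "g' \<noteq> 0" using less.prems(1) \<pi>(2) by auto
    have d\<pi>: "degree \<pi> > 0" using \<pi>(1) by (auto simp: irreducible_def)
    have "\<pi> dvd r"
    proof (rule ccontr)
      assume nd: "\<not> \<pi> dvd r"
      have cancel: "\<pi> ^ n dvd c" if "\<pi> ^ n dvd c * r ^ m" "n > 0" for n m
        using that
      proof (induction m)
        case (Suc m)
        from Suc.prems(1) have "\<pi> ^ n dvd r * (c * r ^ m)" by (simp only: power_Suc ac_simps)
        then have "\<pi> ^ n dvd c * r ^ m"
          by (rule prime_power_dvd_multD[OF prime _ Suc.prems(2) nd])
        from Suc.IH[OF this Suc.prems(2)] show ?case .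
      qed simp
      \<comment> \<open>For this exponent \<open>\<pi>\<^sup>n\<close> has too large a degree to divide \<open>c\<close>.\<close>
      let ?n = "Suc (degree c)"
      have "\<pi> ^ ?n dvd g ^ ?n" unfolding \<pi>(2) power_mult_distrib by simp
      then have "\<pi> ^ ?n dvd c * r ^ ?n" using less.prems(2) by (rule dvd_trans)
      then have "\<pi> ^ ?n dvd c" by (rule cancel) simp
      then have "degree (\<pi> ^ ?n) \<le> degree c" using assms(2) by (rule dvd_imp_degree_le)
      moreover have "degree (\<pi> ^ ?n) = ?n * degree \<pi>" using \<pi>0(1) by (rule Polynomial.degree_power_eq)
      moreover have "?n * 1 \<le> ?n * degree \<pi>" using d\<pi> by (intro mult_le_mono2) simp
      ultimately show False by simp
    qed
    then obtain r' where r': "r = \<pi> * r'" by (elim dvdE)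
    have "g' dvd r'"
    proof (rule less.hyps)
      show "degree g' < degree g" unfolding \<pi>(2) using \<pi>0 d\<pi> by (simp add: degree_mult_eq)
      show "g' \<noteq> 0" by fact
      fix n
      have "\<pi> ^ n * g' ^ n dvd \<pi> ^ n * (c * r' ^ n)"
        using less.prems(2)[of n] unfolding \<pi>(2) r' by (simp add: power_mult_distrib ac_simps)
      then show "g' ^ n dvd c * r' ^ n" using \<pi>0 by simp
    qed
    then show ?thesis unfolding \<pi>(2) r' by (rule mult_dvd_mono[OF dvd_refl])
  qed
qed

lemma poly_eq_if_infinite:
  fixes p q :: "'a::idom poly"
  assumes "infinite A" "\<And>x. x \<in> A \<Longrightarrow> poly p x = poly q x"
  shows "p = q"
proof (rule ccontr)
  assume "p \<noteq> q"
  then have "finite {x. poly (p - q) x = 0}" by (intro poly_roots_finite) simp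
  moreover have "A \<subseteq> {x. poly (p - q) x = 0}" using assms(2) by auto
  ultimately show False using assms(1) finite_subset by blast
qed

text \<open>
  Comparing degrees in \<open>X = \<sigma>(W)(h)\<close> gives \<open>deg W \<cdot> deg h = 1\<close>; preimages of constants are then constant.
  The lemma is used both for root preservers and for algebra automorphisms.
\<close>

lemma substitution_surjective:
  fixes \<sigma> :: "'l::field \<Rightarrow> 'l"
  assumes "field_hom \<sigma>" and surj: "surj (\<lambda>p. pcompose (map_poly \<sigma> p) h)"
  shows "\<exists>a b. a \<noteq> 0 \<and> h = [:b, a:]" "bij \<sigma>"
proof -
  interpret \<sigma>: field_hom \<sigma> by fact
  obtain W where W: "[:0, 1:] = pcompose (map_poly \<sigma> W) h" using surj by (rule surjE)
  have "degree (pcompose (map_poly \<sigma> W) h) = 1" by (simp flip: W)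
  then have "degree (map_poly \<sigma> W) * degree h = 1" by (simp add: degree_pcompose)
  then have h: "degree h = 1" by simp
  obtain b h' where h': "h = pCons b h'" by (cases h)
  with h have "degree h' = 0" "h' \<noteq> 0" by (auto split: if_splits)
  then obtain a where "h' = [:a:]" "a \<noteq> 0" by (metis degree_eq_zeroE pCons_0_0)
  with h' show "\<exists>a b. a \<noteq> 0 \<and> h = [:b, a:]" by blast
  have "\<exists>u. v = \<sigma> u" for v
  proof -
    obtain p where p: "[:v:] = pcompose (map_poly \<sigma> p) h" using surj by (rule surjE)
    have "degree (pcompose (map_poly \<sigma> p) h) = 0" by (simp flip: p)
    then have "degree p * degree h = 0" by (simp add: degree_pcompose)
    with h have "degree p = 0" by simp
    then obtain u where "p = [:u:]" by (metis degree_eq_zeroE)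
    with p show ?thesis by (auto simp: \<sigma>.map_poly_pCons_hom)
  qed
  then show "bij \<sigma>" by (auto simp: bij_def inj_def surj_def)
qed

text \<open>
  What the determination of \<open>f\<close> uses about roots is isolated here: an injective map \<open>\<tau>\<close> of points that
  is compatible with \<open>f\<close>.
\<close>

locale point_mover = finite_extension_basis hom Bs
  for hom :: "'k::field \<Rightarrow> 'l::field" and Bs +
  fixes f :: "'l poly \<Rightarrow> 'l poly" and \<tau> :: "'l \<Rightarrow> 'l"
  assumes infinite_base: "infinite (UNIV :: 'k set)"
    and add: "f (p + q) = f p + f q"
    and scale: "f (smult (hom k) p) = smult (hom k) (f p)"
    and bij_f: "bij f"
    and inj_\<tau>: "inj \<tau>"
    and move: "poly p x = 0 \<Longrightarrow> poly (f p) (\<tau> x) = 0"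
begin

abbreviation A :: "'l \<Rightarrow> 'l poly" where "A u \<equiv> f [:u:]"

lemma f_0: "f 0 = 0" using scale[of 0 0] by simp

lemma f_diff: "f (p - q) = f p - f q"
  using add[of "p - q" q] by (simp add: algebra_simps)

text \<open>
  The value of \<open>f p\<close> at \<open>\<tau> x\<close> depends only on the value of \<open>p\<close> at \<open>x\<close>, as \<open>p\<close> may be replaced by a constant.
\<close>

lemma poly_f: "poly (f p) (\<tau> x) = poly (A (poly p x)) (\<tau> x)"
  using move[of "p - [:poly p x:]" x] by (simp add: f_diff)

lemma A_add: "A (u + v) = A u + A v" by (simp flip: add)

lemma A_scale: "A (hom k * u) = smult (hom k) (A u)" by (simp flip: scale)

lemma A_nonzero: "u \<noteq> 0 \<Longrightarrow> A u \<noteq> 0"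
  using bij_f f_0 by (metis bij_is_inj inj_eq pCons_eq_0_iff)

lemma infinite_orbit: "infinite (range (\<lambda>k. \<tau> (x + hom k)))"
proof -
  have "inj (\<lambda>k. \<tau> (x + hom k))"
  proof (rule injI)
    fix k k' assume "\<tau> (x + hom k) = \<tau> (x + hom k')"
    from injD[OF inj_\<tau> this] show "k = k'" by simp
  qed
  with infinite_base show ?thesis by (simp add: finite_image_iff)
qed

text \<open>
  At \<open>y = \<tau> k\<close> with \<open>k \<in> K\<close>, linearity over \<open>K\<close> gives \<open>f(uX\<^sup>n)(y) = k\<^sup>n A\<^sub>u(y)\<close>. Eliminating the unknown \<open>k\<close>
  leaves an identity of polynomials that holds at infinitely many points.
\<close>

lemma f_monom_times: "f (monom u n) * A 1 ^ n = f (monom 1 1) ^ n * A u"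
proof (rule poly_eq_if_infinite[OF infinite_orbit[of 0]])
  fix y assume "y \<in> range (\<lambda>k. \<tau> (0 + hom k))"
  then obtain k where y: "y = \<tau> (hom k)" by auto
  have m: "poly (f (monom u n)) y = hom k ^ n * poly (A u) y" for u n
    unfolding y poly_f[of "monom u n"]
    using A_scale[of "k ^ n" u] by (simp add: poly_monom hom_power mult.commute)
  show "poly (f (monom u n) * A 1 ^ n) y = poly (f (monom 1 1) ^ n * A u) y"
    by (simp add: m power_mult_distrib)
qed

lemma A_1_dvd: "A 1 dvd f (monom 1 1)"
proof (rule power_dvd_imp_dvd)
  show "A 1 \<noteq> 0" "A 1 \<noteq> 0" by (simp_all add: A_nonzero)
  fix n
  have "A 1 ^ n dvd f (monom 1 n) * A 1 ^ n" by simp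
  then show "A 1 ^ n dvd A 1 * f (monom 1 1) ^ n"
    unfolding f_monom_times by (simp only: mult.commute)
qed

text \<open>
  The polynomial that turns out to be \<open>aX + b\<close>; the division is exact.
\<close>

definition h :: "'l poly" where "h = f (monom 1 1) div A 1"

lemma f_X: "f (monom 1 1) = A 1 * h" using A_1_dvd by (simp add: h_def)

lemma f_monom: "f (monom u n) = h ^ n * A u"
  using f_monom_times[of u n] A_nonzero[of 1] unfolding f_X by (simp add: power_mult_distrib)

text \<open>
  The points \<open>\<tau> (x + k)\<close> with \<open>k \<in> K\<close> are used here. At such a point \<open>y\<close> one has
  \<open>A\<^bsub>ux\<^esub>(y) = (h(y) - k) A\<^sub>u(y)\<close> for all \<open>u\<close>, with a factor that does not depend on \<open>u\<close>.
\<close>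

lemma A_mult: "A (u * x) * A 1 = A x * A u"
proof (rule poly_eq_if_infinite[OF infinite_orbit[of x]])
  fix y assume "y \<in> range (\<lambda>k. \<tau> (x + hom k))"
  then obtain k where y: "y = \<tau> (x + hom k)" by auto
  have *: "poly h y * poly (A u) y = poly (A (u * x)) y + hom k * poly (A u) y" for u
  proof -
    have "poly h y * poly (A u) y = poly (f (monom u 1)) y" by (simp add: f_monom)
    also have "\<dots> = poly (A (u * x + hom k * u)) y"
      unfolding y poly_f[of "monom u 1"] by (simp add: poly_monom algebra_simps)
    also have "\<dots> = poly (A (u * x)) y + hom k * poly (A u) y"
      unfolding A_add A_scale by simp
    finally show ?thesis .
  qed
  from *[of u] have "poly (A (u * x)) y = (poly h y - hom k) * poly (A u) y" by (simp add: algebra_simps)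
  moreover from *[of 1] have "poly (A x) y = (poly h y - hom k) * poly (A 1) y" by (simp add: algebra_simps)
  ultimately show "poly (A (u * x) * A 1) y = poly (A x * A u) y" by simp
qed

lemma A_power: "A (x ^ n) * A 1 ^ n = A x ^ n * A 1"
proof (induction n)
  case (Suc n)
  have "A (x ^ Suc n) * A 1 ^ Suc n = (A (x ^ n * x) * A 1) * A 1 ^ n" by (simp add: ac_simps)
  also have "\<dots> = A x * (A (x ^ n) * A 1 ^ n)" unfolding A_mult by (simp add: ac_simps)
  also have "\<dots> = A x ^ Suc n * A 1" unfolding Suc.IH by (simp add: ac_simps)
  finally show ?case .
qed simp

text \<open>
  Put \<open>r = A\<^sub>x/A\<^sub>1\<close>. All \<open>A\<^sub>1 r\<^sup>n = A\<^bsub>x\<^sup>n\<^esub>\<close> are polynomials, so \<open>r\<close> is one; their degrees are bounded,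
  so \<open>r\<close> is constant.
\<close>

lemma A_proportional: "\<exists>s. A x = smult s (A 1)"
proof -
  note nz = A_nonzero[of 1, simplified]
  have "A 1 dvd A x"
  proof (rule power_dvd_imp_dvd)
    show "A 1 \<noteq> 0" "A 1 \<noteq> 0" by (simp_all add: A_nonzero)
    fix n
    have "A 1 ^ n dvd A (x ^ n) * A 1 ^ n" by simp
    then show "A 1 ^ n dvd A 1 * A x ^ n" unfolding A_power by (simp only: mult.commute)
  qed
  then obtain r where r: "A x = A 1 * r" by (elim dvdE)
  have pow: "A (x ^ n) = A 1 * r ^ n" for n
    using A_power[of x n] nz unfolding r by (simp add: power_mult_distrib)
  obtain N where N: "\<And>u. degree (A u) \<le> N"
    using bounded_degree_on_constants[of f] add scale by metis
  have "degree r = 0"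
  proof (cases "r = 0")
    case False
    have "degree (A 1 * r ^ (N + 1)) \<le> N" unfolding pow[symmetric] by (rule N)
    then have "degree (A 1) + (N + 1) * degree r \<le> N"
      using False nz by (simp add: degree_mult_eq degree_power_eq mult.commute)
    then have "(N + 1) * degree r \<le> N" by simp
    then show ?thesis by (cases "degree r") auto
  qed simp
  then obtain s where "r = [:s:]" by (metis degree_eq_zeroE)
  with r show ?thesis by (intro exI[of _ s]) simp
qed

definition \<sigma> :: "'l \<Rightarrow> 'l" where "\<sigma> x = (SOME s. A x = smult s (A 1))"

lemma A_eq: "A x = smult (\<sigma> x) (A 1)"
  unfolding \<sigma>_def by (rule someI_ex[OF A_proportional])

lemma \<sigma>_eqI: "A x = smult s (A 1) \<Longrightarrow> \<sigma> x = s"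
proof -
  assume "A x = smult s (A 1)"
  with A_eq[of x] have "smult (\<sigma> x - s) (A 1) = 0" by (simp add: smult_diff_left)
  with A_nonzero[of 1] show ?thesis by simp
qed

lemma field_hom_\<sigma>: "field_hom \<sigma>"
proof
  show "\<sigma> 0 = 0" by (rule \<sigma>_eqI) (simp add: f_0)
  show "\<sigma> 1 = 1" by (rule \<sigma>_eqI) simp
  show "\<sigma> (x + y) = \<sigma> x + \<sigma> y" for x y
    by (rule \<sigma>_eqI) (metis A_add A_eq smult_add_left)
  show "\<sigma> (x * y) = \<sigma> x * \<sigma> y" for x y
  proof (rule \<sigma>_eqI)
    have "A (x * y) * A 1 = smult (\<sigma> y) (A 1) * smult (\<sigma> x) (A 1)"
      unfolding A_mult A_eq[of x, symmetric] A_eq[of y, symmetric] ..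
    also have "\<dots> = smult (\<sigma> x * \<sigma> y) (A 1) * A 1"
      by (simp only: mult_smult_left mult_smult_right smult_smult mult.commute)
    finally show "A (x * y) = smult (\<sigma> x * \<sigma> y) (A 1)"
      by (rule mult_right_cancel[OF A_nonzero[OF one_neq_zero], THEN iffD1])
  qed
qed

lemma \<sigma>_fixes: "\<sigma> (hom k) = hom k"
  using A_scale[of k 1] by (intro \<sigma>_eqI) (simp only: mult_1_right)

lemma f_eq: "f p = A 1 * pcompose (map_poly \<sigma> p) h"
proof -
  interpret \<sigma>: field_hom \<sigma> by (rule field_hom_\<sigma>)
  have mult_X: "f (pCons 0 p) = h * f p" for p
  proof -
    have sum: "f (\<Sum>i\<in>I. g i) = (\<Sum>i\<in>I. f (g i))" for I :: "nat set" and g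
      by (induction I rule: infinite_finite_induct) (simp_all add: f_0 add)
    have p: "p = (\<Sum>i\<le>degree p. monom (coeff p i) i)" by (simp add: poly_as_sum_of_monoms)
    have "pCons 0 p = monom 1 1 * p" by (simp add: monom_altdef)
    also have "\<dots> = (\<Sum>i\<le>degree p. monom (coeff p i) (Suc i))"
      by (subst p) (simp add: sum_distrib_left mult_monom)
    finally have "f (pCons 0 p) = (\<Sum>i\<le>degree p. h * f (monom (coeff p i) i))"
      by (simp add: sum f_monom ac_simps)
    also have "\<dots> = h * f p"
      unfolding sum_distrib_left[symmetric] sum[symmetric] p[symmetric] ..
    finally show ?thesis .
  qed
  show ?thesis
  proof (induction p)
    case (pCons a p)
    have "f (pCons a p) = A a + f (pCons 0 p)" by (simp flip: add)
    also have "\<dots> = smult (\<sigma> a) (A 1) + h * (A 1 * pcompose (map_poly \<sigma> p) h)"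
      unfolding mult_X pCons.IH by (subst A_eq) (rule refl)
    also have "\<dots> = A 1 * pcompose (map_poly \<sigma> (pCons a p)) h"
      by (simp add: \<sigma>.map_poly_pCons_hom pcompose_pCons algebra_simps)
    finally show ?case .
  qed (simp add: f_0)
qed

text \<open>
  The polynomial \<open>A\<^sub>1\<close> divides every value of \<open>f\<close>, so it is a unit by surjectivity.
\<close>

lemma affine_form:
  "\<exists>a c b. a \<noteq> 0 \<and> c \<noteq> 0 \<and>
    (\<exists>\<sigma> \<in> field_Aut hom. \<forall>P. f P = smult c (pcompose (map_poly \<sigma> P) [:b, a:]))"
proof -
  interpret \<sigma>: field_hom \<sigma> by (rule field_hom_\<sigma>)
  have surj: "\<exists>p. q = f p" for q using bij_f by (metis bij_pointE)
  obtain p where "1 = f p" using surj[of 1] by blast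
  then have "1 = A 1 * pcompose (map_poly \<sigma> p) h" using f_eq[of p] by (rule trans)
  then have "is_unit (A 1)" by (rule dvdI)
  then have "degree (A 1) = 0" "A 1 \<noteq> 0" unfolding is_unit_field_poly by blast+
  then obtain c where c: "A 1 = [:c:]" "c \<noteq> 0" by (metis degree_eq_zeroE pCons_0_0)
  then have f: "f p = smult c (pcompose (map_poly \<sigma> p) h)" for p unfolding f_eq[of p] by simp
  have "surj (\<lambda>p. pcompose (map_poly \<sigma> p) h)"
    unfolding surj_def
  proof
    fix q
    obtain p where "smult c q = f p" using surj by blast
    then have "smult c q = smult c (pcompose (map_poly \<sigma> p) h)" using f[of p] by (rule trans)
    from arg_cong[OF this, of "smult (inverse c)"] c(2) have "q = pcompose (map_poly \<sigma> p) h" by simp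
    then show "\<exists>p. q = pcompose (map_poly \<sigma> p) h" by (rule exI)
  qed
  from substitution_surjective[OF field_hom_\<sigma> this]
  obtain a b where ab: "a \<noteq> 0" "h = [:b, a:]" and "bij \<sigma>" by blast
  with \<sigma>_fixes have "\<sigma> \<in> field_Aut hom"
    by (simp add: field_Aut_def \<sigma>.comm_ring_hom_axioms)
  then show ?thesis using f[unfolded ab(2)] ab(1) c(2) by blast
qed

end

context finite_extension_basis
begin

text \<open>
  The inverse of \<open>f\<close> also moves points. Applied to the image of \<open>X - w\<close>, this recovers \<open>w\<close> from
  \<open>\<tau> w\<close>, so \<open>\<tau>\<close> is injective.
\<close>

lemma root_preserver_affine:
  assumes hil: "hilbertian TYPE('k)" and sep: "separable_extension hom"
    and f: "f \<in> root_preservers hom"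
  shows "\<exists>a c b. a \<noteq> 0 \<and> c \<noteq> 0 \<and>
    (\<exists>\<sigma> \<in> field_Aut hom. \<forall>P. f P = smult c (pcompose (map_poly \<sigma> P) [:b, a:]))"
proof -
  have inf: "infinite (UNIV :: 'k set)"
    using hil[unfolded hilbertian_def, rule_format, of "{}"] by simp
  have bij: "bij f" using f unfolding root_preservers_iff by blast
  obtain \<tau> where \<tau>: "\<And>x p. poly p x = 0 \<Longrightarrow> poly (f p) (\<tau> x) = 0"
    using root_preserver_moves_points[OF hil sep f] by metis
  have "inj \<tau>"
  proof (rule injI)
    fix x x' assume eq: "\<tau> x = \<tau> x'"
    \<comment> \<open>The inverse of \<open>f\<close> sends polynomials vanishing at \<open>\<tau> x\<close> to polynomials vanishing at \<open>z\<close>.\<close>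
    obtain z where z: "\<And>p. poly p (\<tau> x) = 0 \<Longrightarrow> poly (inv_into UNIV f p) z = 0"
      using root_preserver_moves_points[OF hil sep root_preservers_inv[OF f]] by blast
    have "w = z" if "\<tau> w = \<tau> x" for w
    proof -
      have "poly (f [:- w, 1:]) (\<tau> x) = 0" using \<tau>[of "[:- w, 1:]" w] that by simp
      from z[OF this] show ?thesis using bij by (simp add: bij_is_inj)
    qed
    with eq show "x = x'" by metis
  qed
  interpret point_mover hom Bs f \<tau>
    using f inf \<tau> \<open>inj \<tau>\<close> unfolding root_preservers_iff
    by (intro point_mover.intro finite_extension_basis_axioms point_mover_axioms.intro) blast+
  show ?thesis by (rule affine_form)
qed

end

section \<open>Algebra automorphisms and the semidirect product\<close>

lemma mem_Bij_UNIV: "f \<in> Bij UNIV \<longleftrightarrow> bij f"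
  by (simp add: Bij_def extensional_def)

lemma BijGroup_UNIV_mult: "bij f \<Longrightarrow> bij g \<Longrightarrow> f \<otimes>\<^bsub>BijGroup UNIV\<^esub> g = f \<circ> g"
  by (simp add: BijGroup_def mem_Bij_UNIV compose_def fun_eq_iff)

lemma BijGroup_UNIV_inv: "bij f \<Longrightarrow> inv\<^bsub>BijGroup UNIV\<^esub> f = inv_into UNIV f"
  by (simp add: inv_BijGroup mem_Bij_UNIV restrict_def)

context field_extension
begin

text \<open>
  A ring automorphism of \<open>L[X]\<close> preserves the units, so it restricts to an endomorphism \<open>\<sigma>\<close> of \<open>L\<close>, and it
  is determined by \<open>\<sigma>\<close> and the image of \<open>X\<close>.
\<close>

lemma poly_alg_Aut_iff:
  "\<phi> \<in> poly_alg_Aut hom \<longleftrightarrow>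
    (\<exists>\<sigma> \<in> field_Aut hom. \<exists>a b. a \<noteq> 0 \<and> \<phi> = (\<lambda>P. pcompose (map_poly \<sigma> P) [:b, a:]))"
proof
  assume "\<phi> \<in> poly_alg_Aut hom"
  then have hom: "comm_ring_hom \<phi>" and bij: "bij \<phi>" and fixes_K: "\<And>k. \<phi> [:hom k:] = [:hom k:]"
    by (auto simp: poly_alg_Aut_def)
  interpret \<phi>: comm_ring_hom \<phi> by fact
  have const: "\<exists>s. \<phi> [:u:] = [:s:]" for u
  proof (cases "u = 0")
    case False
    then have "[:u:] dvd 1" by (simp add: is_unit_field_poly)
    then have "\<phi> [:u:] dvd 1" by (rule \<phi>.hom_dvd_1)
    then show ?thesis unfolding is_unit_field_poly by (metis degree_eq_zeroE)
  qed auto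
  then obtain \<sigma> where \<sigma>: "\<And>u. \<phi> [:u:] = [:\<sigma> u:]" by metis
  have "field_hom \<sigma>"
  proof
    show "\<sigma> 0 = 0" using \<sigma>[of 0] by simp
    have "[:\<sigma> 1:] = [:1:]" using \<sigma>[of 1] \<phi>.hom_one by (simp add: one_pCons)
    then show "\<sigma> 1 = 1" by simp
    show "\<sigma> (x + y) = \<sigma> x + \<sigma> y" for x y
      using \<sigma>[of "x + y"] \<phi>.hom_add[of "[:x:]" "[:y:]"] by (simp add: \<sigma>)
    show "\<sigma> (x * y) = \<sigma> x * \<sigma> y" for x y
      using \<sigma>[of "x * y"] \<phi>.hom_mult[of "[:x:]" "[:y:]"] by (simp add: \<sigma> mult.commute)
  qed
  then interpret \<sigma>: field_hom \<sigma> .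
  define h where "h = \<phi> [:0, 1:]"
  have \<phi>: "\<phi> P = pcompose (map_poly \<sigma> P) h" for P
  proof (induction P)
    case (pCons a P)
    have "pCons a P = [:a:] + [:0, 1:] * P" by simp
    then have "\<phi> (pCons a P) = \<phi> [:a:] + h * \<phi> P" unfolding h_def by (metis \<phi>.hom_add \<phi>.hom_mult)
    then show ?case by (simp add: \<sigma> pCons.IH \<sigma>.map_poly_pCons_hom pcompose_pCons)
  qed simp
  have eq: "\<phi> = (\<lambda>P. pcompose (map_poly \<sigma> P) h)" using \<phi> by (rule ext)
  with bij_is_surj[OF bij] have "surj (\<lambda>P. pcompose (map_poly \<sigma> P) h)" by simp
  from substitution_surjective[OF \<sigma>.field_hom_axioms this]
  obtain a b where ab: "a \<noteq> 0" "h = [:b, a:]" and "bij \<sigma>" by blast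
  have "\<sigma> (hom k) = hom k" for k using \<sigma>[of "hom k"] fixes_K[of k] by simp
  with \<open>bij \<sigma>\<close> have "\<sigma> \<in> field_Aut hom" by (simp add: field_Aut_def \<sigma>.comm_ring_hom_axioms)
  then show "\<exists>\<sigma> \<in> field_Aut hom. \<exists>a b. a \<noteq> 0 \<and> \<phi> = (\<lambda>P. pcompose (map_poly \<sigma> P) [:b, a:])"
    using eq[unfolded ab(2)] ab(1) by blast
next
  assume "\<exists>\<sigma> \<in> field_Aut hom. \<exists>a b. a \<noteq> 0 \<and> \<phi> = (\<lambda>P. pcompose (map_poly \<sigma> P) [:b, a:])"
  then obtain \<sigma> a b where \<sigma>: "comm_ring_hom \<sigma>" "bij \<sigma>" "\<And>k. \<sigma> (hom k) = hom k" and a: "a \<noteq> 0"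
    and \<phi>: "\<phi> = (\<lambda>P. pcompose (map_poly \<sigma> P) [:b, a:])"
    by (auto simp: field_Aut_def)
  interpret \<sigma>: comm_ring_hom \<sigma> by fact
  interpret \<sigma>: field_hom \<sigma> ..
  interpret m\<sigma>: map_poly_inj_idom_hom \<sigma> ..
  have "comm_ring_hom \<phi>"
    unfolding \<phi>
    by unfold_locales (simp_all add: m\<sigma>.hom_add m\<sigma>.hom_mult pcompose_add pcompose_mult pcompose_1)
  moreover have "bij \<phi>"
  proof (rule bijI)
    show "inj \<phi>"
    proof (rule injI)
      fix P Q assume "\<phi> P = \<phi> Q"
      then have "pcompose (map_poly \<sigma> (P - Q)) [:b, a:] = 0"
        by (simp add: \<phi> m\<sigma>.hom_minus pcompose_diff)
      then have "map_poly \<sigma> (P - Q) = 0" by (rule pcompose_eq_0) (use a in simp)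
      then show "P = Q" by simp
    qed
    show "surj \<phi>"
      unfolding surj_def
    proof
      fix R
      define S where "S = pcompose R [:- (b / a), 1 / a:]"
      define P where "P = map_poly (inv_into UNIV \<sigma>) S"
      have inv0: "inv_into UNIV \<sigma> 0 = 0" using inv_into_f_f[OF bij_is_inj[OF \<sigma>(2)], of 0] by simp
      have "map_poly \<sigma> P = S"
        using \<sigma>(2) by (simp add: poly_eq_iff P_def coeff_map_poly inv0 bij_is_surj surj_f_inv_f)
      then have "\<phi> P = pcompose S [:b, a:]" by (simp only: \<phi>)
      also have "\<dots> = pcompose R (pcompose [:- (b / a), 1 / a:] [:b, a:])"
        unfolding S_def by (rule pcompose_assoc[symmetric])
      also have "pcompose [:- (b / a), 1 / a:] [:b, a:] = [:0, 1:]"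
        using a by (simp add: pcompose_pCons)
      finally show "\<exists>P. R = \<phi> P" by (metis pcompose_idR)
    qed
  qed
  moreover have "\<phi> [:hom k:] = [:hom k:]" for k by (simp add: \<phi> \<sigma>(3) \<sigma>.map_poly_pCons_hom)
  ultimately show "\<phi> \<in> poly_alg_Aut hom" by (simp add: poly_alg_Aut_def)
qed

lemma poly_alg_Aut_has_root_iff:
  assumes "\<phi> \<in> poly_alg_Aut hom"
  shows "(\<exists>x. poly (\<phi> P) x = 0) \<longleftrightarrow> (\<exists>x. poly P x = 0)"
proof -
  from assms obtain \<sigma> a b where \<sigma>: "comm_ring_hom \<sigma>" "bij \<sigma>" and a: "a \<noteq> 0"
    and \<phi>: "\<phi> = (\<lambda>P. pcompose (map_poly \<sigma> P) [:b, a:])"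
    unfolding poly_alg_Aut_iff by (auto simp: field_Aut_def)
  interpret \<sigma>: comm_ring_hom \<sigma> by fact
  interpret \<sigma>: field_hom \<sigma> ..
  have ev: "poly (\<phi> P) ((\<sigma> x - b) / a) = \<sigma> (poly P x)" for x
    using a by (simp add: \<phi> poly_pcompose)
  show ?thesis
  proof
    assume "\<exists>y. poly (\<phi> P) y = 0"
    then obtain y where y: "poly (\<phi> P) y = 0" ..
    obtain x where "b + a * y = \<sigma> x" using \<sigma>(2) by (metis bij_pointE)
    then have "y = (\<sigma> x - b) / a" using a by (simp add: field_simps)
    with y ev[of x] show "\<exists>x. poly P x = 0" by auto
  next
    assume "\<exists>x. poly P x = 0"
    then obtain x where "poly P x = 0" ..
    with ev[of x] show "\<exists>x. poly (\<phi> P) x = 0" by auto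
  qed
qed

lemma smult_poly_alg_Aut_in_root_preservers:
  assumes "c \<noteq> 0" and \<phi>: "\<phi> \<in> poly_alg_Aut hom"
  shows "(\<lambda>P. smult c (\<phi> P)) \<in> root_preservers hom"
proof -
  have hom: "comm_ring_hom \<phi>" and bij: "bij \<phi>" and fixes_K: "\<And>k. \<phi> [:hom k:] = [:hom k:]"
    using \<phi> by (auto simp: poly_alg_Aut_def)
  interpret \<phi>: comm_ring_hom \<phi> by fact
  have scale: "\<phi> (smult (hom k) p) = smult (hom k) (\<phi> p)" for k p
    using \<phi>.hom_mult[of "[:hom k:]" p] by (simp add: fixes_K)
  have "bij (smult c :: 'e poly \<Rightarrow> _)"
    by (rule o_bij[of "smult (inverse c)"]) (use assms(1) in \<open>auto simp: fun_eq_iff\<close>)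
  from bij_comp[OF bij this] have "bij (\<lambda>P. smult c (\<phi> P))" by (simp add: o_def)
  then show ?thesis
    unfolding root_preservers_iff
    using assms(1) poly_alg_Aut_has_root_iff[OF \<phi>]
    by (simp add: \<phi>.hom_add scale smult_add_right mult.commute)
qed

lemma id_in_poly_alg_Aut: "id \<in> poly_alg_Aut hom"
  by (auto simp: poly_alg_Aut_def intro!: comm_ring_hom.intro ring_hom.intro) (unfold_locales, auto)

lemma comp_in_poly_alg_Aut:
  assumes "\<phi> \<in> poly_alg_Aut hom" "\<psi> \<in> poly_alg_Aut hom"
  shows "\<phi> \<circ> \<psi> \<in> poly_alg_Aut hom"
proof -
  interpret \<phi>: comm_ring_hom \<phi> using assms(1) by (simp add: poly_alg_Aut_def)
  interpret \<psi>: comm_ring_hom \<psi> using assms(2) by (simp add: poly_alg_Aut_def)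
  have "comm_ring_hom (\<phi> \<circ> \<psi>)"
    by unfold_locales (simp_all add: \<phi>.hom_add \<psi>.hom_add \<phi>.hom_mult \<psi>.hom_mult)
  with assms show ?thesis by (auto simp: poly_alg_Aut_def intro: bij_comp)
qed

lemma inv_in_poly_alg_Aut:
  assumes "\<phi> \<in> poly_alg_Aut hom"
  shows "inv_into UNIV \<phi> \<in> poly_alg_Aut hom"
proof -
  interpret \<phi>: comm_ring_hom \<phi> using assms by (simp add: poly_alg_Aut_def)
  have bij: "bij \<phi>" and k: "\<And>k. \<phi> [:hom k:] = [:hom k:]" using assms by (auto simp: poly_alg_Aut_def)
  have r: "\<phi> (inv_into UNIV \<phi> p) = p" for p using bij by (simp add: bij_is_surj surj_f_inv_f)
  have eqI: "inv_into UNIV \<phi> p = q" if "p = \<phi> q" for p q using that bij by (simp add: bij_is_inj)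
  have "comm_ring_hom (inv_into UNIV \<phi>)"
    by unfold_locales (auto intro!: eqI simp: \<phi>.hom_add \<phi>.hom_mult r)
  moreover have "inv_into UNIV \<phi> [:hom k:] = [:hom k:]" for k by (rule eqI) (simp add: k)
  ultimately show ?thesis using bij by (simp add: poly_alg_Aut_def bij_imp_bij_inv)
qed

lemma scalings_subset_root_preservers: "scalings \<subseteq> root_preservers hom"
  using smult_poly_alg_Aut_in_root_preservers[OF _ id_in_poly_alg_Aut] by (auto simp: scalings_def)

lemma poly_alg_Aut_subset_root_preservers: "poly_alg_Aut hom \<subseteq> root_preservers hom"
  using smult_poly_alg_Aut_in_root_preservers[of 1] by auto

lemma root_preservers_subset_Bij: "root_preservers hom \<subseteq> carrier (BijGroup UNIV)"
  by (auto simp: BijGroup_def mem_Bij_UNIV root_preservers_iff)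

lemma comp_in_root_preservers:
  assumes "f \<in> root_preservers hom" "g \<in> root_preservers hom"
  shows "f \<circ> g \<in> root_preservers hom"
  using assms unfolding root_preservers_iff by (simp add: bij_comp)

lemma subgroup_of_root_preservers:
  assumes sub: "H \<subseteq> root_preservers hom" and id: "id \<in> H"
    and comp: "\<And>f g. f \<in> H \<Longrightarrow> g \<in> H \<Longrightarrow> f \<circ> g \<in> H"
    and inv: "\<And>f. f \<in> H \<Longrightarrow> inv_into UNIV f \<in> H"
  shows "subgroup H (BijGroup UNIV)"
proof -
  have bij: "bij f" if "f \<in> H" for f using that sub by (auto simp: root_preservers_iff)
  interpret group "BijGroup (UNIV :: 'e poly set)" by (rule group_BijGroup)
  show ?thesis
  proof (rule subgroupI)
    show "H \<subseteq> carrier (BijGroup UNIV)" using sub root_preservers_subset_Bij by blast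
    show "H \<noteq> {}" using id by blast
    show "inv\<^bsub>BijGroup UNIV\<^esub> f \<in> H" if "f \<in> H" for f
      using that by (simp add: BijGroup_UNIV_inv bij inv)
    show "f \<otimes>\<^bsub>BijGroup UNIV\<^esub> g \<in> H" if "f \<in> H" "g \<in> H" for f g
      using that by (simp add: BijGroup_UNIV_mult bij comp)
  qed
qed

lemma subgroup_root_preservers: "subgroup (root_preservers hom) (BijGroup UNIV)"
  by (rule subgroup_of_root_preservers)
    (use poly_alg_Aut_subset_root_preservers id_in_poly_alg_Aut in
      \<open>auto intro: comp_in_root_preservers root_preservers_inv\<close>)

lemma subgroup_poly_alg_Aut: "subgroup (poly_alg_Aut hom) (BijGroup UNIV)"
  by (rule subgroup_of_root_preservers[OF poly_alg_Aut_subset_root_preservers])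
    (auto intro: id_in_poly_alg_Aut comp_in_poly_alg_Aut inv_in_poly_alg_Aut)

lemma subgroup_scalings: "subgroup scalings (BijGroup (UNIV :: 'e poly set))"
proof (rule subgroup_of_root_preservers[OF scalings_subset_root_preservers])
  have "id = (smult 1 :: 'e poly \<Rightarrow> _)" by (simp add: fun_eq_iff)
  then show "id \<in> (scalings :: ('e poly \<Rightarrow> _) set)" unfolding scalings_def by fastforce
next
  fix f g :: "'e poly \<Rightarrow> 'e poly" assume "f \<in> scalings" "g \<in> scalings"
  then obtain c d where *: "f = smult c" "c \<noteq> 0" "g = smult d" "d \<noteq> 0" by (auto simp: scalings_def)
  then have "f \<circ> g = smult (c * d)" "c * d \<noteq> 0" by (auto simp: fun_eq_iff)
  then show "f \<circ> g \<in> scalings" unfolding scalings_def by blast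
next
  fix f :: "'e poly \<Rightarrow> 'e poly" assume "f \<in> scalings"
  then obtain c where c: "f = smult c" "c \<noteq> 0" by (auto simp: scalings_def)
  have "inv_into UNIV f = smult (inverse c)"
    unfolding c(1) by (rule inv_unique_comp) (use c(2) in \<open>auto simp: fun_eq_iff\<close>)
  with c(2) show "inv_into UNIV f \<in> scalings" by (auto simp: scalings_def)
qed

text \<open>
  An algebra automorphism maps a nonzero constant \<open>c\<close> to a nonzero constant \<open>s\<close>, so conjugation by it
  turns scaling by \<open>c\<close> into scaling by \<open>s\<close>; this is why the scalings are normal. A scaling that is
  an algebra automorphism fixes \<open>1\<close> and is trivial.
\<close>

lemma root_preservers_semidirect_product:
  assumes eq: "root_preservers hom = {\<lambda>P. smult c (\<phi> P) | c \<phi>. c \<noteq> 0 \<and> \<phi> \<in> poly_alg_Aut hom}"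
  shows "is_semidirect_product (root_preserver_group hom) scalings (poly_alg_Aut hom)"
proof -
  let ?B = "BijGroup (UNIV :: 'e poly set)" and ?G = "root_preserver_group hom"
  interpret B: group ?B by (rule group_BijGroup)
  interpret G: group ?G
    unfolding root_preserver_group_def by (rule B.subgroup_imp_group[OF subgroup_root_preservers])
  have carrier: "carrier ?G = root_preservers hom" by (simp add: root_preserver_group_def)
  have bij: "bij f" if "f \<in> root_preservers hom" for f using that by (simp add: root_preservers_iff)
  have mult: "f \<otimes>\<^bsub>?G\<^esub> g = f \<circ> g" if "f \<in> root_preservers hom" "g \<in> root_preservers hom" for f g
    using that by (simp add: root_preserver_group_def BijGroup_UNIV_mult bij)
  have one: "\<one>\<^bsub>?G\<^esub> = id" by (simp add: root_preserver_group_def BijGroup_def fun_eq_iff)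
  have sN: "subgroup scalings ?G"
    unfolding root_preserver_group_def
    by (rule B.subgroup_incl[OF subgroup_scalings subgroup_root_preservers scalings_subset_root_preservers])
  have sH: "subgroup (poly_alg_Aut hom) ?G"
    unfolding root_preserver_group_def
    by (rule B.subgroup_incl[OF subgroup_poly_alg_Aut subgroup_root_preservers
          poly_alg_Aut_subset_root_preservers])
  have const: "\<exists>s. s \<noteq> 0 \<and> (\<forall>P. \<phi> (smult c P) = smult s (\<phi> P))"
    if \<phi>: "\<phi> \<in> poly_alg_Aut hom" and c: "c \<noteq> 0" for \<phi> c
  proof -
    interpret \<phi>: comm_ring_hom \<phi> using \<phi> by (simp add: poly_alg_Aut_def)
    have "[:c:] dvd 1" using c by simp
    then have "\<phi> [:c:] dvd 1" by (rule \<phi>.hom_dvd_1)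
    then obtain s where s: "\<phi> [:c:] = [:s:]" "s \<noteq> 0"
      unfolding is_unit_field_poly by (metis degree_eq_zeroE pCons_0_0)
    have "\<phi> (smult c P) = smult s (\<phi> P)" for P
      using \<phi>.hom_mult[of "[:c:]" P] by (simp add: s)
    with s(2) show ?thesis by blast
  qed
  have "normal scalings ?G"
    unfolding G.normal_inv_iff
  proof (intro conjI ballI sN)
    fix f n assume f: "f \<in> carrier ?G" and n: "n \<in> (scalings :: ('e poly \<Rightarrow> _) set)"
    from f[unfolded carrier eq] obtain d \<phi> where d: "f = (\<lambda>P. smult d (\<phi> P))" "d \<noteq> 0"
      and \<phi>: "\<phi> \<in> poly_alg_Aut hom" by blast
    from n obtain c where c: "n = smult c" "c \<noteq> 0" by (auto simp: scalings_def)
    from const[OF \<phi> c(2)] obtain s where s: "s \<noteq> 0" "\<And>P. \<phi> (smult c P) = smult s (\<phi> P)" by blast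
    have sm: "smult s \<in> (scalings :: ('e poly \<Rightarrow> _) set)" using s(1) by (auto simp: scalings_def)
    have in_G: "n \<in> root_preservers hom" "smult s \<in> root_preservers hom"
      using n sm scalings_subset_root_preservers by blast+
    have "f \<otimes>\<^bsub>?G\<^esub> n = f \<circ> n" using f in_G unfolding carrier by (intro mult)
    also have "\<dots> = smult s \<circ> f" by (simp add: fun_eq_iff c(1) d(1) s(2) mult.commute)
    also have "\<dots> = smult s \<otimes>\<^bsub>?G\<^esub> f" using f in_G unfolding carrier by (intro mult[symmetric])
    finally have "f \<otimes>\<^bsub>?G\<^esub> n \<otimes>\<^bsub>?G\<^esub> inv\<^bsub>?G\<^esub> f = smult s"
      using f in_G(2) unfolding carrier[symmetric] by (simp add: G.m_assoc)
    with sm show "f \<otimes>\<^bsub>?G\<^esub> n \<otimes>\<^bsub>?G\<^esub> inv\<^bsub>?G\<^esub> f \<in> scalings" by simp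
  qed
  moreover have "scalings \<inter> poly_alg_Aut hom = {\<one>\<^bsub>?G\<^esub>}"
  proof
    show "{\<one>\<^bsub>?G\<^esub>} \<subseteq> scalings \<inter> poly_alg_Aut hom"
      using subgroup.one_closed[OF sN] subgroup.one_closed[OF sH] by blast
    show "scalings \<inter> poly_alg_Aut hom \<subseteq> {\<one>\<^bsub>?G\<^esub>}"
    proof
      fix f :: "'e poly \<Rightarrow> 'e poly" assume f: "f \<in> scalings \<inter> poly_alg_Aut hom"
      then obtain c where c: "f = smult c" by (auto simp: scalings_def)
      interpret f: comm_ring_hom f using f by (simp add: poly_alg_Aut_def)
      have "f 1 = 1" by (rule f.hom_one)
      then have "c = 1" by (simp add: c one_pCons)
      then show "f \<in> {\<one>\<^bsub>?G\<^esub>}" by (simp add: c one fun_eq_iff)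
    qed
  qed
  moreover have "scalings <#>\<^bsub>?G\<^esub> poly_alg_Aut hom = carrier ?G"
  proof -
    have prod: "smult c \<otimes>\<^bsub>?G\<^esub> \<phi> = (\<lambda>P. smult c (\<phi> P))"
      if "c \<noteq> 0" "\<phi> \<in> poly_alg_Aut hom" for c \<phi>
    proof -
      have "smult c \<in> root_preservers hom"
        using that(1) scalings_subset_root_preservers by (auto simp: scalings_def)
      moreover have "\<phi> \<in> root_preservers hom" using that(2) poly_alg_Aut_subset_root_preservers by blast
      ultimately show ?thesis by (simp add: mult o_def)
    qed
    show ?thesis
    proof
      show "scalings <#>\<^bsub>?G\<^esub> poly_alg_Aut hom \<subseteq> carrier ?G"
      proof
        fix f assume "f \<in> scalings <#>\<^bsub>?G\<^esub> poly_alg_Aut hom"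
        then obtain c \<phi> where "c \<noteq> 0" "\<phi> \<in> poly_alg_Aut hom" "f = smult c \<otimes>\<^bsub>?G\<^esub> \<phi>"
          by (auto simp: set_mult_def scalings_def)
        then show "f \<in> carrier ?G" unfolding carrier eq using prod by (intro CollectI exI conjI) simp_all
      qed
      show "carrier ?G \<subseteq> scalings <#>\<^bsub>?G\<^esub> poly_alg_Aut hom"
      proof
        fix f assume "f \<in> carrier ?G"
        then obtain c \<phi> where *: "c \<noteq> 0" "\<phi> \<in> poly_alg_Aut hom" "f = (\<lambda>P. smult c (\<phi> P))"
          unfolding carrier eq by blast
        then have "f = smult c \<otimes>\<^bsub>?G\<^esub> \<phi>" using prod by simp
        with *(1,2) show "f \<in> scalings <#>\<^bsub>?G\<^esub> poly_alg_Aut hom"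
          unfolding set_mult_def scalings_def by blast
      qed
    qed
  qed
  ultimately show ?thesis using sH by (simp add: is_semidirect_product_def)
qed

end

context finite_extension_basis
begin

lemma root_preservers_eq:
  assumes hil: "hilbertian TYPE('k)" and sep: "separable_extension hom"
  shows "root_preservers hom = {\<lambda>P. smult c (\<phi> P) | c \<phi>. c \<noteq> 0 \<and> \<phi> \<in> poly_alg_Aut hom}"
proof
  show "root_preservers hom \<subseteq> {\<lambda>P. smult c (\<phi> P) | c \<phi>. c \<noteq> 0 \<and> \<phi> \<in> poly_alg_Aut hom}"
  proof
    fix f assume "f \<in> root_preservers hom"
    from root_preserver_affine[OF hil sep this] obtain a c b \<sigma> where *: "a \<noteq> 0" "c \<noteq> 0"
      "\<sigma> \<in> field_Aut hom" "\<And>P. f P = smult c (pcompose (map_poly \<sigma> P) [:b, a:])" by blast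
    then have "(\<lambda>P. pcompose (map_poly \<sigma> P) [:b, a:]) \<in> poly_alg_Aut hom"
      unfolding poly_alg_Aut_iff by blast
    moreover have "f = (\<lambda>P. smult c (pcompose (map_poly \<sigma> P) [:b, a:]))" using *(4) by (rule ext)
    ultimately show "f \<in> {\<lambda>P. smult c (\<phi> P) | c \<phi>. c \<noteq> 0 \<and> \<phi> \<in> poly_alg_Aut hom}"
      using *(2) by (intro CollectI exI conjI)
  qed
  show "{\<lambda>P. smult c (\<phi> P) | c \<phi>. c \<noteq> 0 \<and> \<phi> \<in> poly_alg_Aut hom} \<subseteq> root_preservers hom"
    using smult_poly_alg_Aut_in_root_preservers by blast
qed

end

theorem theorem4p1:
  fixes \<iota> :: "'k::field \<Rightarrow> 'l::field"
  assumes "hilbertian TYPE('k)"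
    and "finite_extension \<iota>"
    and "separable_extension \<iota>"
  shows "(\<forall>f \<in> root_preservers \<iota>. \<exists>a c b. a \<noteq> 0 \<and> c \<noteq> 0 \<and>
            (\<exists>\<sigma> \<in> field_Aut \<iota>. \<forall>P. f P = smult c (pcompose (map_poly \<sigma> P) [:b, a:])))
       \<and> root_preservers \<iota> = {\<lambda>P. smult c (\<phi> P) | c \<phi>. c \<noteq> 0 \<and> \<phi> \<in> poly_alg_Aut \<iota>}
       \<and> is_semidirect_product (root_preserver_group \<iota>) scalings (poly_alg_Aut \<iota>)"
proof -
  from assms(2) obtain Bs where hom: "comm_ring_hom \<iota>"
    and fd: "finite_dimensional_vector_space (\<lambda>k x. \<iota> k * x) Bs"
    by (auto simp: finite_extension_def)
  interpret fd: finite_dimensional_vector_space "\<lambda>k x. \<iota> k * x" Bs by (rule fd)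
  interpret comm_ring_hom \<iota> by (rule hom)
  interpret finite_extension_basis \<iota> Bs
    using fd.finite_Basis fd.independent_Basis fd.span_Basis by unfold_locales auto
  have "\<forall>f \<in> root_preservers \<iota>. \<exists>a c b. a \<noteq> 0 \<and> c \<noteq> 0 \<and>
      (\<exists>\<sigma> \<in> field_Aut \<iota>. \<forall>P. f P = smult c (pcompose (map_poly \<sigma> P) [:b, a:]))"
    using root_preserver_affine[OF assms(1,3)] by blast
  with root_preservers_eq[OF assms(1,3)] root_preservers_semidirect_product show ?thesis by blast
qed

end
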